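(* Let $r\ge2$ and let $s,p,n$ be positive integers with $n=5p=2r+s$ and $p+s+2=n+1$. The monodromy group $G$ of each of the two trees with passport $[r^2,1^s;5^p;n]$ is isomorphic to a semidirect product $$G\cong\begin{cases}A_p^5\rtimes\mathbb{Z}_5 & \text{if } r\equiv 1\pmod 2,\\ A_p^5\rtimes(\mathbb{Z}_2^4\rtimes\mathbb{Z}_5) & \text{if } r\equiv 0\pmod 2.\end{cases}$$
   Context: A tree is a bicolored (black/white) plane tree, up to color- and orientation-preserving isomorphism. The passport $[\alpha;\beta;n]$ of a tree with $n$ edges records the partition $\alpha\vdash n$ of black vertex degrees and $\beta\vdash n$ of white vertex degrees ($k^m$ means $k$ repeated $m$ times). Label the edges by $1,\dots,n$; let $\sigma_0\in S_n$ (resp. $\sigma_1$) be the permutation whose cycles are the cyclic orders of edges around the black (resp. white) vertices. The monodromy group is $\langle\sigma_0,\sigma_1\rangle\le S_n$ (well defined up to conjugacy). Under the stated conditions there are exactly two trees with this passport. $A_m$ is the alternating group and $\mathbb{Z}_m$ the cyclic group of order $m$. *)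

theory Defs
  imports
    "HOL-Algebra.Algebra"
    "HOL-Combinatorics.Orbits"
    "HOL-Library.Multiset"
begin

text \<open>
  A bicolored plane tree is given combinatorially, by a tree with a black/white colouring of its
  vertices and a cyclic order (a rotation system) on the edges around each vertex; these data
  determine the embedding into the oriented plane up to orientation-preserving homeomorphism.
  Since a tree has no multiple edges, an edge is the pair (black end, white end).
\<close>

record 'v bicolored_map =
  black :: "'v set"
  white :: "'v set"
  edges :: "('v \<times> 'v) set"
  rot :: "'v \<Rightarrow> 'v \<times> 'v \<Rightarrow> 'v \<times> 'v"
    \<comment> \<open>\<open>rot T v e\<close> is the counterclockwise successor of the edge \<open>e\<close> around its end \<open>v\<close>;
      other values of \<open>rot\<close> are irrelevant\<close>

definition incident :: "'v bicolored_map \<Rightarrow> 'v \<Rightarrow> ('v \<times> 'v) set" where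
  "incident T v = {e \<in> edges T. fst e = v \<or> snd e = v}"

definition vertex_degree :: "'v bicolored_map \<Rightarrow> 'v \<Rightarrow> nat" where
  "vertex_degree T v = card (incident T v)"

definition adjacent :: "'v bicolored_map \<Rightarrow> 'v \<Rightarrow> 'v \<Rightarrow> bool" where
  "adjacent T u v \<longleftrightarrow> (u, v) \<in> edges T \<or> (v, u) \<in> edges T"

definition connected_map :: "'v bicolored_map \<Rightarrow> bool" where
  "connected_map T \<longleftrightarrow> black T \<union> white T \<noteq> {} \<and>
     (\<forall>u \<in> black T \<union> white T. \<forall>v \<in> black T \<union> white T. (adjacent T)\<^sup>*\<^sup>* u v)"

definition acyclic_map :: "'v bicolored_map \<Rightarrow> bool" where
  "acyclic_map T \<longleftrightarrow>
     (\<nexists>c. length c \<ge> 3 \<and> distinct c \<and> successively (adjacent T) c \<and> adjacent T (last c) (hd c))"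

definition bicolored_plane_tree :: "'v bicolored_map \<Rightarrow> bool" where
  "bicolored_plane_tree T \<longleftrightarrow>
     finite (black T) \<and> finite (white T) \<and> black T \<inter> white T = {} \<and>
     edges T \<subseteq> black T \<times> white T \<and>
     connected_map T \<and> acyclic_map T \<and>
     (\<forall>v \<in> black T \<union> white T. incident T v \<noteq> {} \<longrightarrow> cyclic_on (rot T v) (incident T v))"

text \<open>Partitions are represented as multisets of natural numbers.\<close>

definition passport :: "'v bicolored_map \<Rightarrow> nat multiset \<times> nat multiset \<times> nat" where
  "passport T =
     (image_mset (vertex_degree T) (mset_set (black T)),
      image_mset (vertex_degree T) (mset_set (white T)),
      card (edges T))"

definition edge_labelling :: "'v bicolored_map \<Rightarrow> ('v \<times> 'v \<Rightarrow> nat) \<Rightarrow> bool" where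
  "edge_labelling T lab \<longleftrightarrow> bij_betw lab (edges T) {1..card (edges T)}"

definition sigma0 :: "'v bicolored_map \<Rightarrow> ('v \<times> 'v \<Rightarrow> nat) \<Rightarrow> nat \<Rightarrow> nat" where
  "sigma0 T lab i =
     (if i \<in> lab ` edges T
      then let e = inv_into (edges T) lab i in lab (rot T (fst e) e)
      else i)"

definition sigma1 :: "'v bicolored_map \<Rightarrow> ('v \<times> 'v \<Rightarrow> nat) \<Rightarrow> nat \<Rightarrow> nat" where
  "sigma1 T lab i =
     (if i \<in> lab ` edges T
      then let e = inv_into (edges T) lab i in lab (rot T (snd e) e)
      else i)"

definition monodromy_group :: "'v bicolored_map \<Rightarrow> ('v \<times> 'v \<Rightarrow> nat) \<Rightarrow> (nat \<Rightarrow> nat) monoid" where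
  "monodromy_group T lab =
     subgroup_generated (sym_group (card (edges T))) {sigma0 T lab, sigma1 T lab}"

text \<open>
  The external semidirect product of \<open>N\<close> by \<open>H\<close> with respect to an action
  \<open>\<phi> \<in> hom H (AutoGroup N)\<close> of \<open>H\<close> on \<open>N\<close> by automorphisms.
\<close>

definition semidirect_product ::
  "('a, 'c) monoid_scheme \<Rightarrow> ('b, 'd) monoid_scheme \<Rightarrow> ('b \<Rightarrow> 'a \<Rightarrow> 'a) \<Rightarrow> ('a \<times> 'b) monoid" where
  "semidirect_product N H \<phi> =
     \<lparr>carrier = carrier N \<times> carrier H,
      monoid.mult = (\<lambda>(x, h) (y, k). (x \<otimes>\<^bsub>N\<^esub> \<phi> h y, h \<otimes>\<^bsub>H\<^esub> k)),
      one = (\<one>\<^bsub>N\<^esub>, \<one>\<^bsub>H\<^esub>)\<rparr>"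

definition power_group :: "('a, 'c) monoid_scheme \<Rightarrow> nat \<Rightarrow> (nat \<Rightarrow> 'a) monoid" where
  "power_group G k = product_group {..<k} (\<lambda>_. G)"

end

theory Submission
  imports Defs
begin

text \<open>
  Since \<open>p = 2 r - 1\<close>, the two black hubs meet exactly one common white vertex and together they meet
  all of them. Number the five edges around each white vertex cyclically so that every edge at the
  first hub has column \<open>0\<close>; the edges at the second hub then all lie in one other column, and after
  replacing the unit turn by a suitable power of it this is column \<open>1\<close>. In these coordinates
  \<open>\<sigma>\<^sub>1\<close> is a power of the shift of the columns, and \<open>\<sigma>\<^sub>0\<close> consists of an \<open>r\<close>-cycle \<open>a\<close> in
  column \<open>0\<close> and an \<open>r\<close>-cycle \<open>b\<close> in column \<open>1\<close>, whose supports share one point. The commutator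
  of \<open>\<sigma>\<^sub>0\<close> with its shift lives in a single column and is a 3-cycle there; conjugating it by
  \<open>a\<close> and \<open>b\<close> gives the whole alternating group in that column, hence \<open>A\<^sub>p\<^sup>5\<close>. If \<open>r\<close> is odd, \<open>a\<close> and
  \<open>b\<close> are even and nothing else arises. If \<open>r\<close> is even, the shifts of \<open>\<sigma>\<^sub>0\<close> realise all column
  permutations whose signs have product \<open>1\<close>, and powers of a fixed transposition in the columns give
  a shift-invariant complement \<open>\<int>\<^sub>2\<^sup>4\<close> of \<open>A\<^sub>p\<^sup>5\<close> in them.
\<close>

section \<open>Internal semidirect products\<close>

text \<open>Conjugation preserves the image of \<open>N\<close>, and pulling it back along the
  injection \<open>i\<close> gives the action. The factors enter through embeddings rather than as
  subgroups, so that \<open>N\<close> and \<open>H\<close> can be explicit groups. That the product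
  is a group is exported because inverting the isomorphism later requires it.\<close>

lemma (in group) internal_semidirect_product:
  assumes N: "group N" and H: "group H"
    and i: "i \<in> hom N G" "inj_on i (carrier N)"
    and j: "j \<in> hom H G" "inj_on j (carrier H)"
    and conj: "\<And>x h. x \<in> carrier N \<Longrightarrow> h \<in> carrier H \<Longrightarrow>
                 j h \<otimes> i x \<otimes> inv (j h) \<in> i ` carrier N"
    and triv: "i ` carrier N \<inter> j ` carrier H \<subseteq> {\<one>}"
    and gen: "\<And>g. g \<in> carrier G \<Longrightarrow> \<exists>x\<in>carrier N. \<exists>h\<in>carrier H. g = i x \<otimes> j h"
  obtains \<phi> where "\<phi> \<in> hom H (AutoGroup N)"
    and "group (semidirect_product N H \<phi>)"
    and "(\<lambda>(x, h). i x \<otimes> j h) \<in> iso (semidirect_product N H \<phi>) G"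
proof -
  interpret N: group N by fact
  interpret H: group H by fact
  interpret i: group_hom N G i using i by (simp add: group_hom_def group_hom_axioms_def N is_group)
  interpret j: group_hom H G j using j by (simp add: group_hom_def group_hom_axioms_def H is_group)
  \<comment> \<open>Members of \<open>AutoGroup N\<close> must be extensional, hence the restriction
    to the carrier of \<open>N\<close>.\<close>
  define \<phi> where "\<phi> h = (\<lambda>x\<in>carrier N. inv_into (carrier N) i (j h \<otimes> i x \<otimes> inv (j h)))" for h
  have \<phi>_mem: "\<phi> h x \<in> carrier N" and i_\<phi>: "i (\<phi> h x) = j h \<otimes> i x \<otimes> inv (j h)"
    if "h \<in> carrier H" "x \<in> carrier N" for h x
    using conj[OF that(2,1)] that by (simp_all add: \<phi>_def inv_into_into f_inv_into_f)
  have i_eq: "x = y" if "i x = i y" "x \<in> carrier N" "y \<in> carrier N" for x y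
    using i(2) that by (auto dest: inj_onD)
  have \<phi>_mult: "\<phi> h (x \<otimes>\<^bsub>N\<^esub> y) = \<phi> h x \<otimes>\<^bsub>N\<^esub> \<phi> h y"
    if "h \<in> carrier H" "x \<in> carrier N" "y \<in> carrier N" for h x y
    by (rule i_eq) (use that in \<open>simp_all add: \<phi>_mem i_\<phi> m_assoc inv_solve_left\<close>)
  have \<phi>_comp: "\<phi> (h \<otimes>\<^bsub>H\<^esub> k) x = \<phi> h (\<phi> k x)"
    if "h \<in> carrier H" "k \<in> carrier H" "x \<in> carrier N" for h k x
    by (rule i_eq) (use that in \<open>simp_all add: \<phi>_mem i_\<phi> m_assoc inv_mult_group\<close>)
  have \<phi>_one: "\<phi> \<one>\<^bsub>H\<^esub> x = x" if "x \<in> carrier N" for x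
    by (rule i_eq) (use that in \<open>simp_all add: \<phi>_mem i_\<phi>\<close>)
  have \<phi>_auto: "\<phi> h \<in> auto N" if h: "h \<in> carrier H" for h
  proof -
    have "bij_betw (\<phi> h) (carrier N) (carrier N)"
      by (rule bij_betwI[where g = "\<phi> (inv\<^bsub>H\<^esub> h)"])
        (use h in \<open>auto simp: \<phi>_mem \<phi>_one simp flip: \<phi>_comp\<close>)
    then show ?thesis
      using h by (auto simp: auto_def hom_def Bij_def \<phi>_mem \<phi>_mult) (simp add: \<phi>_def)
  qed
  have \<phi>_hom: "\<phi> \<in> hom H (AutoGroup N)"
  proof (rule homI)
    fix h k assume hk: "h \<in> carrier H" "k \<in> carrier H"
    have "\<phi> (h \<otimes>\<^bsub>H\<^esub> k) = compose (carrier N) (\<phi> h) (\<phi> k)"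
    proof
      fix x show "\<phi> (h \<otimes>\<^bsub>H\<^esub> k) x = compose (carrier N) (\<phi> h) (\<phi> k) x"
        by (cases "x \<in> carrier N") (use hk in \<open>auto simp: \<phi>_comp compose_def\<close>, simp add: \<phi>_def)
    qed
    then show "\<phi> (h \<otimes>\<^bsub>H\<^esub> k) = \<phi> h \<otimes>\<^bsub>AutoGroup N\<^esub> \<phi> k"
      using \<phi>_auto[OF hk(1)] \<phi>_auto[OF hk(2)] by (simp add: AutoGroup_def BijGroup_def auto_def)
  qed (simp add: AutoGroup_def \<phi>_auto)
  have cancel: "inv a \<otimes> (a \<otimes> b) = b" if "a \<in> carrier G" "b \<in> carrier G" for a b
    using that by (simp flip: m_assoc)
  let ?S = "semidirect_product N H \<phi>" and ?m = "\<lambda>(x, h). i x \<otimes> j h"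
  have m_mult: "?m ((x, h) \<otimes>\<^bsub>?S\<^esub> (y, k)) = ?m (x, h) \<otimes> ?m (y, k)"
    if "x \<in> carrier N" "y \<in> carrier N" "h \<in> carrier H" "k \<in> carrier H" for x y h k
    using that by (simp add: semidirect_product_def \<phi>_mem i_\<phi> m_assoc cancel)
  have inj: "inj_on ?m (carrier N \<times> carrier H)"
  proof (clarsimp simp: inj_on_def)
    fix x h y k
    assume c: "x \<in> carrier N" "h \<in> carrier H" "y \<in> carrier N" "k \<in> carrier H"
      and eq: "i x \<otimes> j h = i y \<otimes> j k"
    \<comment> \<open>This moves everything from \<open>N\<close> to one side and everything from
      \<open>H\<close> to the other; the common value lies in both images and is therefore
      trivial.\<close>
    have "i (inv\<^bsub>N\<^esub> y \<otimes>\<^bsub>N\<^esub> x) = inv (i y) \<otimes> (i x \<otimes> j h) \<otimes> inv (j h)"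
      using c by (simp add: m_assoc)
    also have "\<dots> = j (k \<otimes>\<^bsub>H\<^esub> inv\<^bsub>H\<^esub> h)"
      unfolding eq using c by (simp add: m_assoc cancel)
    finally have "i (inv\<^bsub>N\<^esub> y \<otimes>\<^bsub>N\<^esub> x) = j (k \<otimes>\<^bsub>H\<^esub> inv\<^bsub>H\<^esub> h)" .
    moreover have "inv\<^bsub>N\<^esub> y \<otimes>\<^bsub>N\<^esub> x \<in> carrier N" "k \<otimes>\<^bsub>H\<^esub> inv\<^bsub>H\<^esub> h \<in> carrier H"
      using c by auto
    ultimately have "i (inv\<^bsub>N\<^esub> y \<otimes>\<^bsub>N\<^esub> x) = \<one>" "j (k \<otimes>\<^bsub>H\<^esub> inv\<^bsub>H\<^esub> h) = \<one>"
      using triv by (metis (no_types, lifting) IntI imageI singletonD subsetD)+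
    with c have "i x = i y" "j h = j k"
      by (simp_all add: inv_solve_left' inv_solve_right' flip: eq)
    then show "x = y \<and> h = k" using c i(2) j(2) by (auto dest: inj_onD)
  qed
  have surj: "?m ` (carrier N \<times> carrier H) = carrier G"
  proof
    show "carrier G \<subseteq> ?m ` (carrier N \<times> carrier H)"
      using gen by fastforce
  qed auto
  have iso: "?m \<in> iso ?S G"
    using inj surj m_mult
    by (auto simp: iso_def hom_def bij_betw_def) (auto simp: semidirect_product_def)
  have \<phi>_N_one: "\<phi> h \<one>\<^bsub>N\<^esub> = \<one>\<^bsub>N\<^esub>" if "h \<in> carrier H" for h
    by (rule i_eq) (use that in \<open>simp_all add: \<phi>_mem i_\<phi>\<close>)
  have "group ?S"
  proof (rule groupI)
    fix z assume "z \<in> carrier ?S"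
    then obtain x h where z: "z = (x, h)" "x \<in> carrier N" "h \<in> carrier H"
      by (auto simp: semidirect_product_def)
    show "\<exists>y\<in>carrier ?S. y \<otimes>\<^bsub>?S\<^esub> z = \<one>\<^bsub>?S\<^esub>"
      by (rule bexI[of _ "(\<phi> (inv\<^bsub>H\<^esub> h) (inv\<^bsub>N\<^esub> x), inv\<^bsub>H\<^esub> h)"])
        (use z in \<open>auto simp: semidirect_product_def \<phi>_mem \<phi>_N_one simp flip: \<phi>_mult\<close>)
  qed (auto simp: semidirect_product_def \<phi>_mem \<phi>_mult \<phi>_comp \<phi>_one N.m_assoc H.m_assoc)
  from \<phi>_hom this iso show thesis by (rule that)
qed

section \<open>Cycles and alternating groups\<close>

text \<open>Iterating from \<open>x\<close> runs through the orbit once before the first return, so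
  the return time \<open>funpow_dist1 f x x\<close> is the size of \<open>S\<close>.\<close>

lemma cyclic_on_bij_betw_funpow:
  assumes "cyclic_on f S" "x \<in> S"
  shows "bij_betw (\<lambda>i. (f ^^ i) x) {..<card S} S" and "(f ^^ card S) x = x"
proof -
  let ?d = "funpow_dist1 f x x"
  have x: "x \<in> orbit f x" and S: "S = orbit f x"
    using assms by (auto simp: cyclic_on_alldef)
  have inj: "inj_on (\<lambda>i. (f ^^ i) x) {0..<?d}"
    by (rule inj_on_funpow_dist1[OF x])
  have im: "S = (\<lambda>i. (f ^^ i) x) ` {0..<?d}"
    unfolding S by (rule orbit_conv_funpow_dist1[OF x])
  have card: "card S = ?d"
    unfolding im using card_image[OF inj] by simp
  show "bij_betw (\<lambda>i. (f ^^ i) x) {..<card S} S"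
    unfolding card lessThan_atLeast0 bij_betw_def using inj im by blast
  show "(f ^^ card S) x = x"
    unfolding card by (rule funpow_dist1_prop[OF x])
qed

lemma cyclic_on_fixed_point:
  assumes "cyclic_on f S" "x \<in> S" "f x = x"
  shows "S = {x}"
  using assms by (metis cyclic_on_alldef orbit_eq_singleton_iff)

text \<open>Every point of \<open>S\<close> lies in its own orbit and so has a predecessor; a
  surjective self-map of a finite set is injective.\<close>

lemma cyclic_on_permutes:
  assumes "cyclic_on f S" "\<And>x. x \<notin> S \<Longrightarrow> f x = x"
  shows "f permutes S"
proof -
  have "S \<subseteq> f ` S"
  proof
    fix y assume y: "y \<in> S"
    then have S: "S = orbit f y" using assms(1) by (auto simp: cyclic_on_alldef)
    then have "y \<in> orbit f y" using y by simp
    then show "y \<in> f ` S" by (cases rule: orbit.cases) (use y S in auto)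
  qed
  moreover have "f ` S \<subseteq> S" using assms(1) by (auto intro: cyclic_on_inI)
  ultimately have im: "f ` S = S" by blast
  then have "inj_on f S"
    by (intro eq_card_imp_inj_on finite_cyclic_on[OF assms(1)]) simp
  with im show ?thesis
    using assms(2) by (intro bij_imp_permutes) (auto simp: bij_betw_def)
qed

lemma funpow_cyclic_on_eq_iff:
  assumes "cyclic_on f S" "x \<in> S" "card S = q" "q > 0"
  shows "(f ^^ i) x = (f ^^ j) x \<longleftrightarrow> i mod q = j mod q"
proof -
  note bij = cyclic_on_bij_betw_funpow[OF assms(1,2), unfolded assms(3)]
  have "(f ^^ i) x = (f ^^ j) x \<longleftrightarrow> (f ^^ (i mod q)) x = (f ^^ (j mod q)) x"
    using bij(2) by (simp add: funpow_mod_eq)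
  also have "\<dots> \<longleftrightarrow> i mod q = j mod q"
    using bij(1) assms(4) by (auto simp: bij_betw_def dest: inj_onD)
  finally show ?thesis .
qed

text \<open>A cycle of length m is a product of m - 1 transpositions. Listing \<open>S\<close> by
  the powers of \<open>f\<close> identifies \<open>f\<close> with a \<open>cycle_of_list\<close>,
  for which this decomposition is available.\<close>

lemma evenperm_cyclic_on:
  assumes "cyclic_on f S" "f permutes S"
  shows "evenperm f \<longleftrightarrow> odd (card S)"
proof -
  obtain x where x: "x \<in> S" using assms(1) by (auto simp: cyclic_on_def)
  note bij = cyclic_on_bij_betw_funpow[OF assms(1) x]
  define cs where "cs = map (\<lambda>i. (f ^^ i) x) [0..<card S]"
  have pos: "card S > 0"
    using finite_cyclic_on[OF assms(1)] x by (auto simp: card_gt_0_iff)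
  have dist: "distinct cs" and set: "set cs = S" and len: "length cs = card S"
    using bij(1) by (auto simp: cs_def distinct_map bij_betw_def lessThan_atLeast0)
  have "cycle_of_list cs y = f y" for y
  proof (cases "y \<in> S")
    case True
    then obtain i where i: "i < card S" "y = (f ^^ i) x"
      using bij(1) by (auto simp: bij_betw_def)
    have "map (cycle_of_list cs) cs = rotate1 cs"
      using cyclic_rotation[OF dist, of 1] by simp
    then have "cycle_of_list cs (cs ! i) = rotate1 cs ! i"
      using i len by (metis nth_map)
    also have "\<dots> = cs ! (Suc i mod card S)"
      using i len by (simp add: nth_rotate1)
    also have "\<dots> = (f ^^ Suc i) x"
      using i bij(2) pos by (cases "Suc i = card S") (auto simp: cs_def)
    finally show ?thesis using i by (simp add: cs_def)
  next
    case False
    then show ?thesis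
      using id_outside_supp[of y cs] set assms(2) by (simp add: permutes_not_in)
  qed
  then have "swapidseq (card S - 1) f"
    using swapidseq_ext_imp_swapidseq[OF swapidseq_ext_of_cycles[OF dist]] len
    by (metis ext)
  from evenperm_unique[OF this refl] show ?thesis
    using pos by auto
qed

section \<open>Generating the alternating group by 3-cycles\<close>

definition three_cycles_on :: "'a set \<Rightarrow> ('a \<Rightarrow> 'a) set" where
  "three_cycles_on T = {cycle_of_list [x, y, z] | x y z. {x, y, z} \<subseteq> T \<and> distinct [x, y, z]}"

lemma three_cycle_rotate:
  "distinct [x, y, z] \<Longrightarrow> cycle_of_list [y, z, x] = cycle_of_list [x, y, z]"
  by (auto simp: fun_eq_iff Transposition.transpose_def)

lemma inv_three_cycle:
  "distinct [x, y, z] \<Longrightarrow> inv' (cycle_of_list [x, y, z]) = cycle_of_list [y, x, z]"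
  by (rule inv_unique_comp) (auto simp: fun_eq_iff Transposition.transpose_def)

text \<open>Conjugating one 3-cycle by another that shares two points with it produces further
  3-cycles. Starting from (x y z), this first replaces \<open>y\<close> by an arbitrary point of
  \<open>T\<close> and then \<open>x\<close> as well, so all 3-cycles through the new point
  \<open>z\<close> appear.\<close>

lemma three_cycles_on_insert:
  assumes comp: "\<And>f g. f \<in> D \<Longrightarrow> g \<in> D \<Longrightarrow> f \<circ> g \<in> D"
    and inv: "\<And>f. f \<in> D \<Longrightarrow> inv' f \<in> D"
    and T: "three_cycles_on T \<subseteq> D"
    and xy: "x \<in> T" "y \<in> T" "x \<noteq> y" and c: "cycle_of_list [x, y, z] \<in> D"
  shows "three_cycles_on (insert z T) \<subseteq> D"
proof (cases "z \<in> T")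
  case True
  then show ?thesis using T by (simp add: insert_absorb)
next
  case z: False
  \<comment> \<open>\<open>R\<close> is invariant under reordering its arguments: rotating the
    entries leaves the cycle unchanged, and swapping two of them inverts it.\<close>
  define R where "R u v w \<longleftrightarrow> distinct [u, v, w] \<and> cycle_of_list [u, v, w] \<in> D" for u v w
  have rot: "R v w u" if "R u v w" for u v w
    using that three_cycle_rotate[of u v w] by (auto simp: R_def)
  have swap: "R v u w" if "R u v w" for u v w
    using that inv[of "cycle_of_list [u, v, w]"] inv_three_cycle[of u v w] by (auto simp: R_def)
  \<comment> \<open>\<open>?p\<close> maps \<open>u\<close> to \<open>v\<close>, \<open>v\<close> to
    \<open>w\<close> and fixes \<open>t\<close>, so conjugating (u v t) by it gives (v w t).\<close>
  have K4: "R v w t" if uvw: "R u v w" and uvt: "R u v t" and "w \<noteq> t" for u v w t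
  proof -
    let ?p = "cycle_of_list [u, v, w]"
    have "?p \<circ> cycle_of_list [u, v, t] \<circ> inv' ?p = cycle_of_list (map ?p [u, v, t])"
      using uvt by (intro conjugation_of_cycle permutation_bijective permutation_of_cycle)
        (simp add: R_def)
    moreover have "map ?p [u, v, t] = [v, w, t]"
      using uvw uvt that(3) by (auto simp: R_def)
    moreover have "?p \<circ> cycle_of_list [u, v, t] \<circ> inv' ?p \<in> D"
      using uvw uvt by (intro comp inv) (simp_all add: R_def)
    ultimately show ?thesis
      using uvw uvt that(3) by (auto simp: R_def)
  qed
  have inT: "R u v w" if "{u, v, w} \<subseteq> T" "distinct [u, v, w]" for u v w
    using that T by (auto simp: R_def three_cycles_on_def)
  have xyz: "R x y z" using c xy z by (auto simp: R_def)
  have xuz: "R x u z" if "u \<in> T" "u \<noteq> x" for u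
  proof (cases "u = y")
    case False
    have "R y x u" using that xy False by (intro inT) auto
    from K4[OF this swap[OF xyz]] show ?thesis using that z by blast
  qed (use xyz in simp)
  have zuv: "R z u v" if "u \<in> T" "v \<in> T" "u \<noteq> v" for u v
  proof -
    consider "u = x" | "v = x" | "u \<noteq> x" "v \<noteq> x" by blast
    then show ?thesis
    proof cases
      case 1 then show ?thesis using xuz[of v] that rot by blast
    next
      case 2 then show ?thesis using xuz[of u] that rot swap by blast
    next
      case 3
      have "R x u v" using that xy 3 by (intro inT) auto
      from K4[OF xuz[OF that(1)] this] show ?thesis using 3 that z rot swap by blast
    qed
  qed
  show ?thesis
  proof
    fix f assume "f \<in> three_cycles_on (insert z T)"
    then obtain u v w where f: "f = cycle_of_list [u, v, w]" "distinct [u, v, w]"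
        "u \<in> insert z T" "v \<in> insert z T" "w \<in> insert z T"
      by (auto simp: three_cycles_on_def)
    then consider "u = z" "v \<in> T" "w \<in> T" | "v = z" "u \<in> T" "w \<in> T"
      | "w = z" "u \<in> T" "v \<in> T" | "u \<in> T" "v \<in> T" "w \<in> T"
      by auto
    then have "R u v w"
    proof cases
      case 1 then show ?thesis using zuv f by simp
    next
      case 2 then show ?thesis using zuv[of w u] f rot by auto
    next
      case 3 then show ?thesis using zuv[of u v] f rot by auto
    next
      case 4 then show ?thesis using f by (intro inT) auto
    qed
    then show "f \<in> D" using f by (simp add: R_def)
  qed
qed

text \<open>Since \<open>A\<close> and \<open>B\<close> meet only in \<open>z\<close>, the two
  orders of composition can disagree only where a point passes through \<open>z\<close>; the
  discrepancy is a 3-cycle.\<close>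

lemma commutator_cycles_meeting_in_a_point:
  assumes a: "a permutes A" and b: "b permutes B" and AB: "A \<inter> B = {z}"
    and az: "a z \<noteq> z" and bz: "b z \<noteq> z"
  shows "b \<circ> a \<circ> inv' b \<circ> inv' a = cycle_of_list [z, b z, a z]"
proof -
  let ?c = "cycle_of_list [z, b z, a z]"
  have zA: "z \<in> A" and zB: "z \<in> B" using AB by auto
  have aA: "a x \<in> A \<longleftrightarrow> x \<in> A" and bB: "b x \<in> B \<longleftrightarrow> x \<in> B" for x
    using a b by (auto simp: permutes_in_image)
  have an: "x \<notin> A \<Longrightarrow> a x = x" and bn: "x \<notin> B \<Longrightarrow> b x = x" for x
    using a b by (auto simp: permutes_not_in)
  have ai: "a x = a y \<longleftrightarrow> x = y" and bi: "b x = b y \<longleftrightarrow> x = y" for x y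
    using a b by (auto simp: permutes_inj inj_eq)
  have azB: "a z \<notin> B" and bzA: "b z \<notin> A" using AB az bz zA zB aA bB by blast+
  have c: "?c z = b z" "?c (b z) = a z" "?c (a z) = z"
    "x \<noteq> z \<Longrightarrow> x \<noteq> b z \<Longrightarrow> x \<noteq> a z \<Longrightarrow> ?c x = x" for x
    using azB bzA az bz aA bB zA zB by (auto simp: Transposition.transpose_def)
  \<comment> \<open>This is the claim freed of inverses, so that it can be checked point by point
    according to membership in \<open>A\<close> and \<open>B\<close>.\<close>
  have "b (a x) = ?c (a (b x))" for x
  proof -
    consider "x = z" | "x \<in> A" "x \<notin> B" | "x \<in> B" "x \<notin> A" | "x \<notin> A" "x \<notin> B"
      using AB by blast
    then show ?thesis
    proof cases
      case 1
      show ?thesis by (simp only: 1 bn[OF azB] an[OF bzA] c(2))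
    next
      case 2
      have n: "a x \<noteq> a z" "a x \<in> A" using 2 zB by (auto simp: ai aA)
      then have "a x \<noteq> b z" using bzA by metis
      moreover have "b (a x) = a x" if "a x \<noteq> z" using that n AB by (intro bn) blast
      ultimately show ?thesis using n by (cases "a x = z") (simp_all only: bn[OF 2(2)] c(1,4) simp_thms)
    next
      case 3
      have n: "b x \<noteq> b z" "b x \<in> B" using 3 zA by (auto simp: bi bB)
      then have "b x \<noteq> a z" using azB by metis
      moreover have "a (b x) = b x" if "b x \<noteq> z" using that n AB by (intro an) blast
      ultimately show ?thesis using n by (cases "b x = z") (simp_all only: an[OF 3(2)] c(3,4) simp_thms)
    next
      case 4
      then have "x \<noteq> z" "x \<noteq> a z" "x \<noteq> b z" using zA zB aA[of z] bB[of z] by metis+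
      then show ?thesis by (simp only: an[OF 4(1)] bn[OF 4(2)] c(4) simp_thms)
    qed
  qed
  then have "b \<circ> a = ?c \<circ> a \<circ> b" by (simp only: fun_eq_iff comp_def) simp
  then have "b \<circ> a \<circ> inv' b \<circ> inv' a = ?c \<circ> (a \<circ> (b \<circ> inv' b) \<circ> inv' a)"
    by (simp only: comp_assoc)
  also have "\<dots> = ?c"
    using permutes_inv_o(1)[OF a] permutes_inv_o(1)[OF b] by (simp only: comp_id)
  finally show ?thesis .
qed

text \<open>Repeated conjugation of the commutator by \<open>a\<close> and by \<open>b\<close>
  yields a chain of 3-cycles, each sharing two points with the set already covered; adding points
  one at a time covers first \<open>A\<close> and then \<open>B\<close>. \<open>D\<close> is assumed
  to be normalised by \<open>a\<close> and \<open>b\<close> rather than to contain them, because in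
  the application they may be odd.\<close>

lemma three_cycles_on_subset_of_meeting_cycles:
  assumes comp: "\<And>f g. f \<in> D \<Longrightarrow> g \<in> D \<Longrightarrow> f \<circ> g \<in> D"
    and inv: "\<And>f. f \<in> D \<Longrightarrow> inv' f \<in> D"
    and conj_a: "\<And>f. f \<in> D \<Longrightarrow> a \<circ> f \<circ> inv' a \<in> D"
    and conj_b: "\<And>f. f \<in> D \<Longrightarrow> b \<circ> f \<circ> inv' b \<in> D"
    and comm: "b \<circ> a \<circ> inv' b \<circ> inv' a \<in> D"
    and a: "a permutes A" "cyclic_on a A" and b: "b permutes B" "cyclic_on b B"
    and AB: "A \<inter> B = {z}" and card: "card A \<ge> 2" "card B \<ge> 2"
  shows "three_cycles_on (A \<union> B) \<subseteq> D"
proof -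
  have zA: "z \<in> A" and zB: "z \<in> B" using AB by auto
  have az: "a z \<noteq> z" and bz: "b z \<noteq> z"
    using cyclic_on_fixed_point[OF a(2) zA] cyclic_on_fixed_point[OF b(2) zB] card by auto
  have aA: "(a ^^ i) z \<in> A" and bB: "(b ^^ i) z \<in> B" for i
    using a(2) b(2) zA zB by (auto intro: cyclic_on_funpow_in)
  have azB: "a z \<notin> B" and bzA: "b z \<notin> A"
    using AB az bz aA[of 1] bB[of 1] by auto
  have c: "cycle_of_list [z, b z, a z] \<in> D"
    using comm unfolding commutator_cycles_meeting_in_a_point[OF a(1) b(1) AB az bz] .
  have conj: "cycle_of_list (map p cs) \<in> D" if "cycle_of_list cs \<in> D" "distinct cs" "p = a \<or> p = b" for p cs
    using conjugation_of_cycle[OF that(2), of p] conj_a[OF that(1)] conj_b[OF that(1)] that(3)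
      permutes_bij[OF a(1)] permutes_bij[OF b(1)] by metis
  have ne: "(a ^^ i) z \<noteq> a ((a ^^ i) z)" "(b ^^ i) z \<noteq> b ((b ^^ i) z)" for i
    using cyclic_on_fixed_point[OF a(2) aA, of i] cyclic_on_fixed_point[OF b(2) bB, of i] card by auto
  have neAB: "(a ^^ i) z \<noteq> b z" "(b ^^ i) z \<noteq> a z" for i
    using aA[of i] bB[of i] azB bzA by metis+
  \<comment> \<open>\<open>a\<close> fixes \<open>b z\<close> and advances the other two entries, so
    each conjugation moves the cycle one step along \<open>A\<close>.\<close>
  have step_a: "cycle_of_list [(a ^^ i) z, b z, (a ^^ Suc i) z] \<in> D" for i
  proof (induction i)
    case (Suc i)
    have "a (b z) = b z" using bzA a(1) by (simp add: permutes_not_in)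
    then show ?case
      using conj[OF Suc, of a] neAB(1)[of i] neAB(1)[of "Suc i"] ne(1)[of i]
      by (simp del: cycle_of_list.simps)
  qed (use c in \<open>simp del: cycle_of_list.simps\<close>)
  have step_b: "cycle_of_list [(b ^^ i) z, (b ^^ Suc i) z, a z] \<in> D" for i
  proof (induction i)
    case (Suc i)
    have "b (a z) = a z" using azB b(1) by (simp add: permutes_not_in)
    then show ?case
      using conj[OF Suc, of b] neAB(2)[of i] neAB(2)[of "Suc i"] ne(2)[of i]
      by (simp del: cycle_of_list.simps)
  qed (use c in \<open>simp del: cycle_of_list.simps\<close>)
  \<comment> \<open>The start \<open>{b z, z}\<close> supports no 3-cycle; each step adjoins the
    next power of \<open>a\<close> by means of \<open>step_a\<close>.\<close>
  have XA: "three_cycles_on (insert (b z) ((\<lambda>j. (a ^^ j) z) ` {..i})) \<subseteq> D" for i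
  proof (induction i)
    case 0
    then show ?case by (auto simp: three_cycles_on_def)
  next
    case (Suc i)
    have "three_cycles_on (insert ((a ^^ Suc i) z) (insert (b z) ((\<lambda>j. (a ^^ j) z) ` {..i}))) \<subseteq> D"
      by (rule three_cycles_on_insert[OF comp inv Suc _ _ neAB(1) step_a]) auto
    then show ?case by (simp add: atMost_Suc insert_commute)
  qed
  have A_eq: "A \<subseteq> (\<lambda>j. (a ^^ j) z) ` {..card A}" and B_eq: "B \<subseteq> (\<lambda>j. (b ^^ j) z) ` {..card B}"
    using cyclic_on_bij_betw_funpow(1)[OF a(2) zA] cyclic_on_bij_betw_funpow(1)[OF b(2) zB]
    by (force simp: bij_betw_def)+
  have mono: "three_cycles_on S \<subseteq> D" if "three_cycles_on T \<subseteq> D" "S \<subseteq> T" for S T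
    using that by (fastforce simp: three_cycles_on_def)
  have XB: "three_cycles_on (A \<union> (\<lambda>j. (b ^^ j) z) ` {..i}) \<subseteq> D" for i
  proof (induction i)
    case 0
    show ?case by (rule mono[OF XA[of "card A"]]) (use A_eq zA in auto)
  next
    case (Suc i)
    let ?x = "(b ^^ i) z" and ?y = "(b ^^ Suc i) z" and ?T = "A \<union> (\<lambda>j. (b ^^ j) z) ` {..i}"
    have d: "distinct [?x, ?y, a z]" using neAB(2)[of i] neAB(2)[of "Suc i"] ne(2)[of i] by simp
    \<comment> \<open>The inverse of the cycle from \<open>step_b\<close>, rotated so that the two
      points already covered come first and the new one last.\<close>
    have c': "cycle_of_list [?x, a z, ?y] \<in> D"
      using inv[OF step_b[of i]] inv_three_cycle[OF d] three_cycle_rotate[of ?y ?x "a z"] d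
      by (simp only: distinct.simps) auto
    have "three_cycles_on (insert ?y ?T) \<subseteq> D"
      by (rule three_cycles_on_insert[OF comp inv Suc _ _ neAB(2) c']) (use aA[of 1] in auto)
    then show ?case by (simp add: atMost_Suc)
  qed
  show ?thesis by (rule mono[OF XB[of "card B"]]) (use B_eq in auto)
qed

text \<open>The 3-cycles generate the alternating group, so membership in \<open>D\<close> passes
  from them to every even permutation by induction over \<open>generate\<close>.\<close>

lemma evenperms_subset_of_meeting_cycles:
  fixes f :: "nat \<Rightarrow> nat"
  assumes id: "id \<in> D"
    and comp: "\<And>f g. f \<in> D \<Longrightarrow> g \<in> D \<Longrightarrow> f \<circ> g \<in> D"
    and inv: "\<And>f. f \<in> D \<Longrightarrow> inv' f \<in> D"
    and conj_a: "\<And>f. f \<in> D \<Longrightarrow> a \<circ> f \<circ> inv' a \<in> D"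
    and conj_b: "\<And>f. f \<in> D \<Longrightarrow> b \<circ> f \<circ> inv' b \<in> D"
    and comm: "b \<circ> a \<circ> inv' b \<circ> inv' a \<in> D"
    and a: "a permutes A" "cyclic_on a A" and b: "b permutes B" "cyclic_on b B"
    and AB: "A \<inter> B = {z}" "A \<union> B = {1..p}" and card: "card A \<ge> 2" "card B \<ge> 2"
    and f: "f permutes {1..p}" "evenperm f"
  shows "f \<in> D"
proof -
  have T: "three_cycles_on {1..p} \<subseteq> D"
    using three_cycles_on_subset_of_meeting_cycles[OF comp inv conj_a conj_b comm a b AB(1) card]
    by (simp add: AB(2))
  have TC: "g \<in> D" if "g \<in> three_cycles p" for g
  proof -
    from that obtain cs where cs: "g = cycle_of_list cs" "distinct cs" "length cs = 3" "set cs \<subseteq> {1..p}"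
      by auto
    then obtain x y w where "cs = [x, y, w]" by (auto simp: length_Suc_conv numeral_3_eq_3)
    then show ?thesis using cs T by (auto simp: three_cycles_on_def)
  qed
  have "f \<in> generate (alt_group p) (three_cycles p)"
    unfolding alt_group_carrier_as_three_cycles[symmetric] alt_group_carrier using f by blast
  then show ?thesis
  proof (induction f rule: generate.induct)
    case one
    show ?case unfolding alt_group_one by (rule id)
  next
    case (eng g h)
    then show ?case unfolding alt_group_mult by (intro comp)
  next
    case (inv h)
    then have "h \<in> carrier (alt_group p)" using three_cycles_incl by blast
    then show ?case using assms(3)[OF TC[OF inv]] by (simp add: alt_group_inv_equality)
  qed (rule TC)
qed

section \<open>Permutations of five columns\<close>

lemma mod_5_shift_back:
  fixes i j k l :: nat
  shows "((j + 4 * k) mod 5 + k) mod 5 = j mod 5"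
    and "(j + 4 * (4 * k)) mod 5 = (j + k) mod 5"
    and "((i + (k + l)) mod 5 + 4 * k) mod 5 = (i + l) mod 5"
proof -
  have "((j + 4 * k) mod 5 + k) mod 5 = (j + k * 5) mod 5"
    by (subst mod_add_left_eq) (simp add: algebra_simps)
  then show "((j + 4 * k) mod 5 + k) mod 5 = j mod 5" by simp
  have "(j + 4 * (4 * k)) mod 5 = (j + k + (3 * k) * 5) mod 5" by (simp add: algebra_simps)
  then show "(j + 4 * (4 * k)) mod 5 = (j + k) mod 5" by (simp only: mod_mult_self1)
  have "((i + (k + l)) mod 5 + 4 * k) mod 5 = (i + l + k * 5) mod 5"
    by (subst mod_add_left_eq) (simp add: algebra_simps)
  then show "((i + (k + l)) mod 5 + 4 * k) mod 5 = (i + l) mod 5" by (simp only: mod_mult_self1)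
qed

lemma bij_betw_shift_mod_5:
  fixes c :: nat
  shows "bij_betw (\<lambda>j. (j + c) mod 5) {..<5} {..<5}"
proof -
  have "inj_on (\<lambda>j. (j + c) mod 5) {..<5}"
  proof (rule inj_onI)
    fix i j assume "i \<in> {..<5}" "j \<in> {..<5}" "(i + c) mod 5 = (j + c) mod 5"
    then show "i = j" using mod_5_shift_back(3)[of i c 0] mod_5_shift_back(3)[of j c 0] by simp
  qed
  moreover have "(\<lambda>j. (j + c) mod 5) ` {..<5} \<subseteq> {..<5}" by auto
  ultimately show ?thesis by (simp add: bij_betw_def endo_inj_surj)
qed

text \<open>Rows will be the white vertices and columns the five edges around each, so \<theta>
  gives the label of an edge. Positivity of \<open>p\<close> provides a row in which a shift of the
  columns is visible.\<close>

locale five_columns =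
  fixes p :: nat and \<theta> :: "nat \<times> nat \<Rightarrow> nat"
  assumes bij_\<theta>: "bij_betw \<theta> ({1..p} \<times> {..<5}) {1..5 * p}" and p_pos: "p > 0"
begin

declare One_nat_def [simp del] \<comment> \<open>keeps the simplifier from turning \<open>{1..p}\<close> into \<open>{Suc 0..p}\<close>\<close>

text \<open>
  \<open>act f k\<close> is the element \<open>(f, k)\<close> of the wreath product of the symmetric group by \<open>\<int>\<^sub>5\<close>: shift the
  columns by \<open>k\<close>, then permute each new column \<open>j\<close> by \<open>f j\<close>. Only \<open>k mod 5\<close> and the \<open>f j\<close> with \<open>j < 5\<close>
  matter, and \<open>4 * k\<close> plays the role of \<open>-k\<close>.
\<close>

definition act :: "(nat \<Rightarrow> nat \<Rightarrow> nat) \<Rightarrow> nat \<Rightarrow> nat \<Rightarrow> nat" where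
  "act f k m =
     (if m \<in> {1..5 * p}
      then let (x, i) = inv_into ({1..p} \<times> {..<5}) \<theta> m in \<theta> (f ((i + k) mod 5) x, (i + k) mod 5)
      else m)"

lemma \<theta>_mem: "x \<in> {1..p} \<Longrightarrow> i < 5 \<Longrightarrow> \<theta> (x, i) \<in> {1..5 * p}"
  using bij_\<theta> by (auto simp: bij_betw_def)

lemma \<theta>_eq_iff:
  "x \<in> {1..p} \<Longrightarrow> i < 5 \<Longrightarrow> y \<in> {1..p} \<Longrightarrow> j < 5 \<Longrightarrow> \<theta> (x, i) = \<theta> (y, j) \<longleftrightarrow> x = y \<and> i = j"
  using bij_\<theta> by (auto simp: bij_betw_def dest: inj_onD)

lemma \<theta>_cases:
  assumes "m \<in> {1..5 * p}"
  obtains x i where "x \<in> {1..p}" "i < 5" "m = \<theta> (x, i)"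
proof -
  have "m \<in> \<theta> ` ({1..p} \<times> {..<5})" using assms bij_\<theta> by (simp add: bij_betw_def)
  then show thesis using that by blast
qed

lemma act_\<theta>:
  assumes "x \<in> {1..p}" "i < 5"
  shows "act f k (\<theta> (x, i)) = \<theta> (f ((i + k) mod 5) x, (i + k) mod 5)"
proof -
  have "inv_into ({1..p} \<times> {..<5}) \<theta> (\<theta> (x, i)) = (x, i)"
    by (rule bij_betw_inv_into_left[OF bij_\<theta>]) (use assms in auto)
  then show ?thesis using \<theta>_mem[OF assms] by (simp add: act_def)
qed

lemma act_outside: "m \<notin> {1..5 * p} \<Longrightarrow> act f k m = m"
  by (auto simp: act_def)

lemma act_eqI:
  assumes "\<And>x i. x \<in> {1..p} \<Longrightarrow> i < 5 \<Longrightarrow> h (\<theta> (x, i)) = \<theta> (f ((i + k) mod 5) x, (i + k) mod 5)"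
    and "\<And>m. m \<notin> {1..5 * p} \<Longrightarrow> h m = m"
  shows "h = act f k"
proof
  fix m show "h m = act f k m"
  proof (cases "m \<in> {1..5 * p}")
    case True
    then obtain x i where "x \<in> {1..p}" "i < 5" "m = \<theta> (x, i)" by (rule \<theta>_cases)
    then show ?thesis by (simp add: assms(1) act_\<theta>)
  next
    case False
    then show ?thesis by (simp only: assms(2) act_outside not_False_eq_True)
  qed
qed

lemma act_cong:
  assumes "\<And>j. j < 5 \<Longrightarrow> f j = g j" "k mod 5 = l mod 5"
  shows "act f k = act g l"
proof (rule act_eqI)
  fix x i :: nat assume "x \<in> {1..p}" "i < 5"
  moreover have "(i + k) mod 5 = (i + l) mod 5" using assms(2) by (intro mod_add_cong refl)
  ultimately show "act f k (\<theta> (x, i)) = \<theta> (g ((i + l) mod 5) x, (i + l) mod 5)"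
    by (simp add: act_\<theta> assms(1))
qed (rule act_outside)

text \<open>What \<open>f\<close> meets in column j was in column j - k before the second shift, and
  there \<open>g\<close> was applied. The hypothesis on \<open>g\<close> keeps rows inside
  \<open>{1..p}\<close> between the two actions.\<close>

lemma act_comp:
  assumes "\<And>j. j < 5 \<Longrightarrow> g j permutes {1..p}"
  shows "act f k \<circ> act g l = act (\<lambda>j. f j \<circ> g ((j + 4 * k) mod 5)) (k + l)"
proof (rule act_eqI)
  fix x i :: nat assume x: "x \<in> {1..p}" "i < 5"
  let ?j = "(i + l) mod 5"
  have "g ?j x \<in> {1..p}" using permutes_in_image[OF assms[of ?j]] x by simp
  moreover have "(?j + k) mod 5 = (i + (k + l)) mod 5"
    "((i + (k + l)) mod 5 + 4 * k) mod 5 = (i + l) mod 5"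
    by (subst mod_add_left_eq, simp add: ac_simps, rule mod_5_shift_back(3))
  ultimately show "(act f k \<circ> act g l) (\<theta> (x, i)) =
      \<theta> ((f ((i + (k + l)) mod 5) \<circ> g (((i + (k + l)) mod 5 + 4 * k) mod 5)) x, (i + (k + l)) mod 5)"
    using x by (simp add: act_\<theta>)
qed (simp add: act_outside)

lemma act_id: "act (\<lambda>_. id) 0 = id"
  by (rule act_eqI[symmetric]) auto

lemma act_inject:
  assumes "act f k = act g l"
    and f: "\<And>j. j < 5 \<Longrightarrow> f j permutes {1..p}" and g: "\<And>j. j < 5 \<Longrightarrow> g j permutes {1..p}"
  shows "k mod 5 = l mod 5" and "j < 5 \<Longrightarrow> f j = g j"
proof -
  have eq: "f ((i + k) mod 5) x = g ((i + l) mod 5) x" "(i + k) mod 5 = (i + l) mod 5"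
    if "x \<in> {1..p}" "i < 5" for x i
  proof -
    have "\<theta> (f ((i + k) mod 5) x, (i + k) mod 5) = \<theta> (g ((i + l) mod 5) x, (i + l) mod 5)"
      using fun_cong[OF assms(1), of "\<theta> (x, i)"] that by (simp add: act_\<theta>)
    moreover have "f ((i + k) mod 5) x \<in> {1..p}" "g ((i + l) mod 5) x \<in> {1..p}"
      using permutes_in_image[OF f] permutes_in_image[OF g] that(1) by simp_all
    ultimately have "f ((i + k) mod 5) x = g ((i + l) mod 5) x \<and> (i + k) mod 5 = (i + l) mod 5"
      by (subst (asm) \<theta>_eq_iff) auto
    then show "f ((i + k) mod 5) x = g ((i + l) mod 5) x" "(i + k) mod 5 = (i + l) mod 5"
      by blast+
  qed
  \<comment> \<open>The point in row 1 and column 0 moves to column \<open>k mod 5\<close>, which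
    reveals the shift.\<close>
  show kl: "k mod 5 = l mod 5" using eq(2)[of 1 0] p_pos by simp
  assume j: "j < 5"
  show "f j = g j"
  proof
    fix x show "f j x = g j x"
    proof (cases "x \<in> {1..p}")
      case True
      \<comment> \<open>Column j - k is carried to column j by both shifts, so comparing there
        isolates \<open>f j\<close> and \<open>g j\<close>.\<close>
      have "((j + 4 * k) mod 5 + k) mod 5 = j" using j by (simp add: mod_5_shift_back(1))
      moreover have "((j + 4 * k) mod 5 + l) mod 5 = ((j + 4 * k) mod 5 + k) mod 5"
        by (intro mod_add_cong refl kl[symmetric])
      ultimately have "((j + 4 * k) mod 5 + k) mod 5 = j" "((j + 4 * k) mod 5 + l) mod 5 = j"
        by simp_all
      then show ?thesis using eq(1)[OF True, of "(j + 4 * k) mod 5"] by simp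
    qed (use f[OF j] g[OF j] in \<open>simp add: permutes_not_in\<close>)
  qed
qed

text \<open>The inverse shifts back by \<open>k\<close> first, so what sits in its new column j came
  from column j + k; the permutation to be undone there is that of column j + k.\<close>

lemma
  assumes f: "\<And>j. j < 5 \<Longrightarrow> f j permutes {1..p}"
  shows act_permutes: "act f k permutes {1..5 * p}"
    and inv_act: "inv' (act f k) = act (\<lambda>j. inv' (f ((j + k) mod 5))) (4 * k)"
proof -
  let ?g = "act (\<lambda>j. inv' (f ((j + k) mod 5))) (4 * k)"
  have inv_p: "inv' (f ((j + k) mod 5)) permutes {1..p}" for j
    by (intro permutes_inv f) simp
  have 1: "act f k \<circ> ?g = id"
  proof -
    have "act f k \<circ> ?g = act (\<lambda>_. id) 0"
      unfolding act_comp[OF inv_p]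
    proof (rule act_cong)
      fix j :: nat assume j: "j < 5"
      then have "((j + 4 * k) mod 5 + k) mod 5 = j" by (simp add: mod_5_shift_back(1))
      then show "f j \<circ> inv' (f (((j + 4 * k) mod 5 + k) mod 5)) = id"
        using permutes_inv_o(1)[OF f[OF j]] by simp
    qed simp
    then show ?thesis by (simp add: act_id)
  qed
  have 2: "?g \<circ> act f k = id"
  proof -
    have "?g \<circ> act f k = act (\<lambda>j. inv' (f ((j + k) mod 5)) \<circ> f ((j + 4 * (4 * k)) mod 5)) (4 * k + k)"
      by (rule act_comp) (rule f)
    also have "\<dots> = act (\<lambda>_. id) 0"
    proof (rule act_cong)
      fix j :: nat
      have "(j + 4 * (4 * k)) mod 5 = (j + k) mod 5" by (rule mod_5_shift_back(2))
      then show "inv' (f ((j + k) mod 5)) \<circ> f ((j + 4 * (4 * k)) mod 5) = id"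
        using permutes_inv_o(2)[OF f[of "(j + k) mod 5"]] by simp
    qed simp
    finally show ?thesis by (simp add: act_id)
  qed
  show "inv' (act f k) = ?g" by (rule inv_unique_comp[OF 1 2])
  have "bij (act f k)" by (rule o_bij[OF 2 1])
  then show "act f k permutes {1..5 * p}"
    by (auto simp: permutes_def bij_iff act_outside)
qed

text \<open>One family serves three purposes. With \<open>U\<close> alternating it is the wreath
  product of A_p by Z_5; with \<open>U\<close> symmetric it is the subgroup of the wreath product of
  S_p by Z_5 on which the column signs multiply to 1; with \<open>U\<close> generated by a
  transposition it is a copy of Z_2^4 extended by Z_5.\<close>

definition wreath :: "(nat \<Rightarrow> nat) set \<Rightarrow> (nat \<Rightarrow> nat) set" where
  "wreath U = {act f k | f k. (\<forall>j<5. f j \<in> U) \<and> (\<Prod>j<5. sign (f j)) = 1}"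

definition base :: "(nat \<Rightarrow> nat) set \<Rightarrow> (nat \<Rightarrow> nat) set" where
  "base U = {act f 0 | f. (\<forall>j<5. f j \<in> U) \<and> (\<Prod>j<5. sign (f j)) = 1}"

lemma wreathI:
  "(\<And>j. j < 5 \<Longrightarrow> f j \<in> U) \<Longrightarrow> (\<Prod>j<5. sign (f j)) = 1 \<Longrightarrow> act f k \<in> wreath U"
  unfolding wreath_def by blast

lemma wreathE:
  assumes "g \<in> wreath U"
  obtains f k where "g = act f k" "\<forall>j<5. f j \<in> U" "(\<Prod>j<5. sign (f j)) = 1"
  using assms unfolding wreath_def by blast

lemma baseI:
  "(\<And>j. j < 5 \<Longrightarrow> f j \<in> U) \<Longrightarrow> (\<Prod>j<5. sign (f j)) = 1 \<Longrightarrow> act f 0 \<in> base U"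
  unfolding base_def by blast

lemma baseE:
  assumes "g \<in> base U"
  obtains f where "g = act f 0" "\<forall>j<5. f j \<in> U" "(\<Prod>j<5. sign (f j)) = 1"
  using assms unfolding base_def by blast

text \<open>The argument is an integer because the elements of \<open>integer_mod_group 5\<close>
  are integers.\<close>

abbreviation rotation :: "int \<Rightarrow> nat \<Rightarrow> nat" where
  "rotation k \<equiv> act (\<lambda>_. id) (nat k)"

text \<open>A shift only permutes the five columns, so it leaves the product of the column signs
  unchanged, and that product is multiplicative.\<close>

lemma subgroup_wreath:
  assumes U: "subgroup U (sym_group p)"
  shows "subgroup (wreath U) (sym_group (5 * p))"
proof -
  interpret U: subgroup U "sym_group p" by fact
  have perm: "f permutes {1..p}" if "f \<in> U" for f
    using U.subset that by (auto simp: sym_group_carrier)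
  have permutation: "permutation f" if "f \<in> U" for f
    using perm[OF that] by (auto simp: permutation_permutes)
  have comp: "f \<circ> g \<in> U" if "f \<in> U" "g \<in> U" for f g
    using U.m_closed[OF that] by (simp add: sym_group_mult)
  have inv: "inv' f \<in> U" if "f \<in> U" for f
    using U.m_inv_closed[OF that] perm[OF that] by (simp add: sym_group_carrier)
  have shift: "(\<Prod>j<5. sign (f ((j + c) mod 5))) = (\<Prod>j<5. sign (f j) :: int)" for f :: "nat \<Rightarrow> nat \<Rightarrow> nat" and c
    by (rule prod.reindex_bij_betw[OF bij_betw_shift_mod_5])
  show ?thesis
  proof (rule group.subgroupI[OF sym_group_is_group])
    show "wreath U \<subseteq> carrier (sym_group (5 * p))"
    proof
      fix g assume "g \<in> wreath U"
      then obtain f k where g: "g = act f k" "\<forall>j<5. f j \<in> U" by (rule wreathE)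
      have "g permutes {1..5 * p}" unfolding g(1) by (rule act_permutes) (use g perm in auto)
      then show "g \<in> carrier (sym_group (5 * p))" by (simp add: sym_group_carrier)
    qed
    have "act (\<lambda>_. id) 0 \<in> wreath U"
      using U.one_closed by (intro wreathI) (simp_all add: sym_group_one)
    then show "wreath U \<noteq> {}" by blast
  next
    fix g assume "g \<in> wreath U"
    then obtain f k where g: "g = act f k" "\<forall>j<5. f j \<in> U" "(\<Prod>j<5. sign (f j)) = 1"
      by (rule wreathE)
    have "inv' g = act (\<lambda>j. inv' (f ((j + k) mod 5))) (4 * k)"
      unfolding g(1) by (rule inv_act) (use g perm in auto)
    moreover have "(\<Prod>j<5. sign (inv' (f ((j + k) mod 5)))) = 1"
      using g shift[of f k] by (simp add: sign_inverse permutation)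
    ultimately have "inv' g \<in> wreath U"
      using g(2) inv by (simp add: wreathI)
    moreover have "g \<in> carrier (sym_group (5 * p))"
      using g perm by (auto simp: sym_group_carrier intro: act_permutes)
    ultimately show "inv\<^bsub>sym_group (5 * p)\<^esub> g \<in> wreath U" by simp
  next
    fix g h assume "g \<in> wreath U" "h \<in> wreath U"
    then obtain f k f' l where g: "g = act f k" "\<forall>j<5. f j \<in> U" "(\<Prod>j<5. sign (f j)) = 1"
      and h: "h = act f' l" "\<forall>j<5. f' j \<in> U" "(\<Prod>j<5. sign (f' j)) = 1"
      by (elim wreathE)
    have "g \<circ> h = act (\<lambda>j. f j \<circ> f' ((j + 4 * k) mod 5)) (k + l)"
      unfolding g(1) h(1) by (rule act_comp) (use h perm in auto)
    moreover have "(\<Prod>j<5. sign (f j \<circ> f' ((j + 4 * k) mod 5))) = 1"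
      using g h shift[of f' "4 * k"] by (simp add: sign_compose permutation prod.distrib)
    ultimately show "g \<otimes>\<^bsub>sym_group (5 * p)\<^esub> h \<in> wreath U"
      using g(2) h(2) comp by (simp add: sym_group_mult wreathI)
  qed
qed

lemma rotation_hom: "rotation \<in> hom (integer_mod_group 5) (sym_group (5 * p))"
proof (rule homI)
  fix k l assume "k \<in> carrier (integer_mod_group 5)" "l \<in> carrier (integer_mod_group 5)"
  then have "nat ((k + l) mod 5) mod 5 = (nat k + nat l) mod 5"
    by (simp add: carrier_integer_mod_group nat_mod_distrib nat_add_distrib)
  then have "rotation ((k + l) mod 5) = act (\<lambda>_. id) (nat k + nat l)"
    by (intro act_cong) simp_all
  then show "rotation (k \<otimes>\<^bsub>integer_mod_group 5\<^esub> l) =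
      rotation k \<otimes>\<^bsub>sym_group (5 * p)\<^esub> rotation l"
    by (simp add: sym_group_mult act_comp)
qed (simp add: sym_group_carrier act_permutes)

lemma inj_rotation: "inj_on rotation (carrier (integer_mod_group 5))"
proof (rule inj_onI)
  fix k l assume kl: "k \<in> carrier (integer_mod_group 5)" "l \<in> carrier (integer_mod_group 5)"
    and "rotation k = rotation l"
  from act_inject(1)[OF this(3)] have "nat k mod 5 = nat l mod 5" by (simp add: )
  then show "k = l" using kl by (simp add: carrier_integer_mod_group nat_less_iff eq_nat_nat_iff)
qed

text \<open>\<open>base U\<close> is normalised by the column shifts, meets them only in the
  identity, and together with them gives all of \<open>wreath U\<close>. \<open>N\<close> is any
  explicit group embedded onto \<open>base U\<close>, so that powers of A_p and of Z_2 are treated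
  alike.\<close>

lemma wreath_semidirect_product:
  assumes U: "subgroup U (sym_group p)"
    and N: "group N" and i: "i \<in> hom N (sym_group (5 * p))" "inj_on i (carrier N)"
    and im: "i ` carrier N = base U"
  obtains \<psi> where "\<psi> \<in> hom (integer_mod_group 5) (AutoGroup N)"
    and "group (semidirect_product N (integer_mod_group 5) \<psi>)"
    and "(\<lambda>(x, k). i x \<circ> rotation k) \<in>
           iso (semidirect_product N (integer_mod_group 5) \<psi>) (sym_group (5 * p)\<lparr>carrier := wreath U\<rparr>)"
proof -
  let ?S = "sym_group (5 * p)" and ?G = "sym_group (5 * p)\<lparr>carrier := wreath U\<rparr>"
  note sub = subgroup_wreath[OF U]
  have perm: "f permutes {1..p}" if "f \<in> U" for f
    using subgroup.subset[OF U] that by (auto simp: sym_group_carrier)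
  have idU: "id \<in> U" using subgroup.one_closed[OF U] by (simp add: sym_group_one)
  interpret G: group ?G by (rule group.subgroup_imp_group[OF sym_group_is_group sub])
  have base: "base U \<subseteq> wreath U" by (auto simp: base_def wreath_def)
  have rot: "rotation k \<in> wreath U" for k
    by (intro wreathI) (simp_all add: idU)
  have invG: "inv\<^bsub>?G\<^esub> g = inv' g" if "g \<in> wreath U" for g
    using group.m_inv_consistent[OF sym_group_is_group sub that] subgroup.subset[OF sub] that
    by auto
  show thesis
  proof (rule G.internal_semidirect_product[OF N group_integer_mod_group, of i rotation 5])
    show "i \<in> hom N ?G"
      using i(1) im base by (auto simp: hom_def)
    show "rotation \<in> hom (integer_mod_group 5) ?G"
      using rotation_hom rot by (auto simp: hom_def)
  next
    fix x k assume x: "x \<in> carrier N"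
    then obtain f where f: "i x = act f 0" "\<forall>j<5. f j \<in> U" "(\<Prod>j<5. sign (f j)) = 1"
      using im by (metis baseE imageI)
    have "rotation k \<circ> i x \<circ> inv' (rotation k) = act (\<lambda>j. f ((j + 4 * nat k) mod 5)) 0"
      unfolding f(1) using f(2) perm
      by (simp add: inv_act act_comp) (intro act_cong, simp_all)
    moreover have "(\<Prod>j<5. sign (f ((j + 4 * nat k) mod 5))) = (\<Prod>j<5. sign (f j) :: int)"
      by (rule prod.reindex_bij_betw[OF bij_betw_shift_mod_5])
    ultimately have "rotation k \<circ> i x \<circ> inv' (rotation k) \<in> base U"
      using f by (simp add: baseI)
    then show "rotation k \<otimes>\<^bsub>?G\<^esub> i x \<otimes>\<^bsub>?G\<^esub> inv\<^bsub>?G\<^esub> (rotation k) \<in> i ` carrier N"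
      unfolding im by (simp add: invG[OF rot] sym_group_mult)
  next
    show "i ` carrier N \<inter> rotation ` carrier (integer_mod_group 5) \<subseteq> {\<one>\<^bsub>?G\<^esub>}"
    proof
      fix g assume "g \<in> i ` carrier N \<inter> rotation ` carrier (integer_mod_group 5)"
      then obtain f k where f: "g = act f 0" "\<forall>j<5. f j \<in> U" and k: "g = rotation k"
        unfolding im by (metis (no_types, lifting) IntE baseE imageE)
      then have "act f 0 = rotation k" by simp
      note act_inject(2)[OF this]
      then have "g = act (\<lambda>_. id) 0"
        unfolding f(1) by (intro act_cong) (use f(2) perm permutes_id in auto)
      then show "g \<in> {\<one>\<^bsub>?G\<^esub>}" by (simp add: act_id sym_group_one)
    qed
  next
    fix g assume "g \<in> carrier ?G"
    then obtain f k where g: "g = act f k" "\<forall>j<5. f j \<in> U" "(\<Prod>j<5. sign (f j)) = 1"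
      by (auto elim: wreathE)
    then have "act f 0 \<in> i ` carrier N" unfolding im by (intro baseI) simp_all
    then obtain x where x: "x \<in> carrier N" "i x = act f 0" by (metis imageE)
    \<comment> \<open>Reducing \<open>k\<close> modulo 5 puts it in the carrier of
      \<open>integer_mod_group 5\<close> without changing the shift.\<close>
    have "g = act f 0 \<circ> rotation (int (k mod 5))"
      unfolding g(1) by (simp add: act_comp) (intro act_cong, simp_all)
    then show "\<exists>x\<in>carrier N. \<exists>k\<in>carrier (integer_mod_group 5). g = i x \<otimes>\<^bsub>?G\<^esub> rotation k"
      using x by (intro bexI[of _ x] bexI[of _ "int (k mod 5)"])
        (simp_all add: sym_group_mult carrier_integer_mod_group)
  qed (use i inj_rotation that in \<open>simp_all add: sym_group_mult\<close>)
qed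

end

section \<open>Generation from two cycles in neighbouring columns\<close>

lemma prod_lessThan_5: "(\<Prod>j<5. g j) = g 0 * g 1 * g 2 * g 3 * (g (4::nat) :: int)"
proof -
  have "{..<5} = {0, 1, 2, 3, 4::nat}" by auto
  then show ?thesis by (simp add: mult_ac)
qed

lemma less_5_cases: "(j::nat) < 5 \<Longrightarrow> j = 0 \<or> j = 1 \<or> j = 2 \<or> j = 3 \<or> j = 4"
  by auto

text \<open>The shape of \<open>sigma0\<close> and, for \<open>m < 4\<close>, of those of its shifts
  that do not wrap around from column 4 to column 0.\<close>

definition pair_at :: "nat \<Rightarrow> (nat \<Rightarrow> nat) \<Rightarrow> (nat \<Rightarrow> nat) \<Rightarrow> nat \<Rightarrow> nat \<Rightarrow> nat" where
  "pair_at m a b j = (if j = m then a else if j = Suc m then b else id)"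

lemma prod_sign_pair_at:
  assumes "m < 4"
  shows "(\<Prod>j<5. sign (pair_at m a b j)) = sign a * sign b"
proof -
  have "m = 0 \<or> m = 1 \<or> m = 2 \<or> m = 3" using assms by auto
  then show ?thesis by (elim disjE) (simp_all add: prod_lessThan_5 pair_at_def)
qed

context five_columns
begin

lemma act_comp_0:
  assumes "\<And>j. j < 5 \<Longrightarrow> g j permutes {1..p}"
  shows "act f 0 \<circ> act g 0 = act (\<lambda>j. f j \<circ> g j) 0"
proof -
  have "act f 0 \<circ> act g 0 = act (\<lambda>j. f j \<circ> g ((j + 4 * 0) mod 5)) (0 + 0)"
    by (rule act_comp) (rule assms)
  also have "\<dots> = act (\<lambda>j. f j \<circ> g j) 0" by (rule act_cong) simp_all
  finally show ?thesis .
qed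

lemma inv_act_0:
  assumes "\<And>j. j < 5 \<Longrightarrow> f j permutes {1..p}"
  shows "inv' (act f 0) = act (\<lambda>j. inv' (f j)) 0"
proof -
  have "inv' (act f 0) = act (\<lambda>j. inv' (f ((j + 0) mod 5))) (4 * 0)"
    by (rule inv_act) (rule assms)
  also have "\<dots> = act (\<lambda>j. inv' (f j)) 0" by (rule act_cong) simp_all
  finally show ?thesis .
qed

lemma conj_rotation:
  assumes "\<And>j. j < 5 \<Longrightarrow> h j permutes {1..p}"
  shows "act (\<lambda>_. id) m \<circ> act h 0 \<circ> act (\<lambda>_. id) (4 * m) = act (\<lambda>j. h ((j + 4 * m) mod 5)) 0"
  using assms by (simp add: act_comp) (intro act_cong, simp_all)

definition single :: "nat \<Rightarrow> (nat \<Rightarrow> nat) \<Rightarrow> nat \<Rightarrow> nat" where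
  "single m f = act (\<lambda>j. if j = m then f else id) 0"

text \<open>The commutator of two neighbouring pairs leads to every even permutation in one column,
  and the shifts carry these to all columns. For even \<open>r\<close> each pair also changes the
  sign in two neighbouring columns at once, which reaches every family with sign product 1.\<close>

lemma act_mem_of_meeting_cycles:
  assumes C: "subgroup C (sym_group (5 * p))"
    and a: "a permutes A" "cyclic_on a A" and b: "b permutes B" "cyclic_on b B"
    and AB: "A \<inter> B = {z}" "A \<union> B = {1..p}" and card: "card A = r" "card B = r" "r \<ge> 2"
    and rot: "\<And>k. act (\<lambda>_. id) k \<in> C" and ab: "act (pair_at 0 a b) 0 \<in> C"
    and f: "\<And>j. j < 5 \<Longrightarrow> f j permutes {1..p}" "(\<Prod>j<5. sign (f j)) = 1"
    and odd: "odd r \<Longrightarrow> (\<forall>j<5. evenperm (f j))"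
  shows "act f k \<in> C"
proof -
  have comp: "g \<circ> h \<in> C" if "g \<in> C" "h \<in> C" for g h
    using subgroup.m_closed[OF C that] by (simp add: sym_group_mult)
  have inv: "inv' g \<in> C" if "g \<in> C" for g
    using subgroup.m_inv_closed[OF C that] subgroup.subset[OF C] that by auto
  have ap: "a permutes {1..p}" and bp: "b permutes {1..p}"
    using a(1) b(1) AB(2) by (auto intro: permutes_subset)
  have pair: "pair_at m a b j permutes {1..p}" for m j
    by (simp add: pair_at_def ap bp permutes_id)
  have abm: "act (pair_at m a b) 0 \<in> C" if "m < 4" for m
  proof -
    have "act (\<lambda>_. id) m \<circ> act (pair_at 0 a b) 0 \<circ> act (\<lambda>_. id) (4 * m) =
        act (\<lambda>j. pair_at 0 a b ((j + 4 * m) mod 5)) 0"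
      by (rule conj_rotation) (rule pair)
    also have "\<dots> = act (pair_at m a b) 0"
    proof (rule act_cong)
      fix j :: nat assume "j < 5"
      then have "j = 0 \<or> j = 1 \<or> j = 2 \<or> j = 3 \<or> j = 4" "m = 0 \<or> m = 1 \<or> m = 2 \<or> m = 3"
        using that by auto
      then show "pair_at 0 a b ((j + 4 * m) mod 5) = pair_at m a b j"
        by (elim disjE) (simp_all add: pair_at_def)
    qed simp
    finally show ?thesis using comp[OF comp[OF rot[of m] ab] rot[of "4 * m"]] by simp
  qed
  \<comment> \<open>In column 1, \<open>pair_at 0 a b\<close> acts by \<open>b\<close> and
    \<open>pair_at 1 a b\<close> acts by \<open>a\<close>, so conjugation by both is available
    there.\<close>
  define D where "D = {g. g permutes {1..p} \<and> single 1 g \<in> C}"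
  have single_perm: "(if j = m then g else id) permutes {1..p}" if "g permutes {1..p}" for g j and m :: nat
    using that by (simp add: permutes_id)
  \<comment> \<open>In every other column the conjugating factor cancels against its inverse, so the
    result stays within column 1.\<close>
  have single_conj: "single 1 (h 1 \<circ> g \<circ> inv' (h 1)) \<in> C"
    if "single 1 g \<in> C" "g permutes {1..p}" "act h 0 \<in> C" "\<And>j. h j permutes {1..p}" for g h
  proof -
    have "act h 0 \<circ> single 1 g \<circ> inv' (act h 0) =
        act (\<lambda>j. h j \<circ> (if j = 1 then g else id) \<circ> inv' (h j)) 0"
      unfolding single_def using that(2,4)
      by (simp add: act_comp_0 inv_act_0 permutes_inv permutes_id)
    also have "\<dots> = single 1 (h 1 \<circ> g \<circ> inv' (h 1))"
      unfolding single_def using permutes_inv_o(1)[OF that(4)] by (intro act_cong) auto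
    finally show ?thesis using comp[OF comp[OF that(3,1)] inv[OF that(3)]] by simp
  qed
  have even_D: "g \<in> D" if g: "g permutes {1..p}" "evenperm g" for g
  proof (rule evenperms_subset_of_meeting_cycles[OF _ _ _ _ _ _ a b AB _ _ g])
    have "single 1 id = act (\<lambda>_. id) 0"
      unfolding single_def by (rule act_cong) simp_all
    then show "id \<in> D" using rot by (simp add: D_def permutes_id)
  next
    fix g h assume gh: "g \<in> D" "h \<in> D"
    have "single 1 g \<circ> single 1 h = act (\<lambda>j. (if j = 1 then g else id) \<circ> (if j = 1 then h else id)) 0"
      unfolding single_def by (rule act_comp_0) (use gh in \<open>simp add: D_def permutes_id\<close>)
    also have "\<dots> = single 1 (g \<circ> h)" unfolding single_def by (rule act_cong) simp_all
    finally show "g \<circ> h \<in> D"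
      using gh comp[of "single 1 g" "single 1 h"] by (simp add: D_def permutes_compose)
  next
    fix g assume g: "g \<in> D"
    have "inv' (single 1 g) = act (\<lambda>j. inv' (if j = 1 then g else id)) 0"
      unfolding single_def by (rule inv_act_0) (use g in \<open>simp add: D_def permutes_id\<close>)
    also have "\<dots> = single 1 (inv' g)" unfolding single_def by (rule act_cong) simp_all
    finally show "inv' g \<in> D"
      using g inv[of "single 1 g"] by (simp add: D_def permutes_inv)
  next
    fix g assume g: "g \<in> D"
    have "single 1 (a \<circ> g \<circ> inv' a) \<in> C"
      using single_conj[of g "pair_at 1 a b"] g abm[of 1] pair by (simp add: D_def pair_at_def)
    then show "a \<circ> g \<circ> inv' a \<in> D"
      using g ap by (simp add: D_def permutes_compose permutes_inv)
  next
    fix g assume g: "g \<in> D"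
    have "single 1 (b \<circ> g \<circ> inv' b) \<in> C"
      using single_conj[of g "pair_at 0 a b"] g abm[of 0] pair by (simp add: D_def pair_at_def)
    then show "b \<circ> g \<circ> inv' b \<in> D"
      using g bp by (simp add: D_def permutes_compose permutes_inv)
  next
    \<comment> \<open>In columns 0 and 2 only one of the two pairs acts and its factor cancels; only
      the commutator in column 1 survives.\<close>
    have "act (pair_at 0 a b) 0 \<circ> act (pair_at 1 a b) 0 \<circ> inv' (act (pair_at 0 a b) 0) \<circ>
        inv' (act (pair_at 1 a b) 0) = act (\<lambda>j. pair_at 0 a b j \<circ> pair_at 1 a b j \<circ>
          inv' (pair_at 0 a b j) \<circ> inv' (pair_at 1 a b j)) 0"
      by (simp add: act_comp_0 inv_act_0 pair permutes_inv)
    also have "\<dots> = single 1 (b \<circ> a \<circ> inv' b \<circ> inv' a)"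
      unfolding single_def using permutes_inv_o(1)[OF ap] permutes_inv_o(1)[OF bp]
      by (intro act_cong) (auto simp: pair_at_def)
    finally show "b \<circ> a \<circ> inv' b \<circ> inv' a \<in> D"
      using comp[OF comp[OF comp[OF abm[of 0] abm[of 1]] inv[OF abm[of 0]]] inv[OF abm[of 1]]] ap bp
      by (simp add: D_def permutes_compose permutes_inv)
  qed (use card in auto)
  have even_single: "single m g \<in> C" if g: "g permutes {1..p}" "evenperm g" and m: "m < 5" for g m
  proof -
    \<comment> \<open>Modulo 5 this is m - 1, the shift that carries column 1 to column
      \<open>m\<close>.\<close>
    let ?m = "m + 4" and ?h = "\<lambda>j. if j = 1 then g else id"
    have "act (\<lambda>_. id) ?m \<circ> single 1 g \<circ> act (\<lambda>_. id) (4 * ?m) = act (\<lambda>j. ?h ((j + 4 * ?m) mod 5)) 0"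
      unfolding single_def by (rule conj_rotation) (rule single_perm[OF g(1)])
    also have "\<dots> = single m g"
      unfolding single_def
    proof (rule act_cong)
      fix j :: nat assume "j < 5"
      from less_5_cases[OF this] less_5_cases[OF m]
      show "?h ((j + 4 * ?m) mod 5) = (if j = m then g else id)"
        by (elim disjE) simp_all
    qed simp
    finally show ?thesis
      using comp[OF comp[OF rot[of ?m], of "single 1 g"] rot[of "4 * ?m"]] even_D[OF g]
      by (simp add: D_def)
  qed
  have even_act: "act f 0 \<in> C" if f: "\<And>j. j < 5 \<Longrightarrow> f j permutes {1..p}" "\<And>j. j < 5 \<Longrightarrow> evenperm (f j)" for f
  proof -
    have "act (\<lambda>j. if j < m then f j else id) 0 \<in> C" if "m \<le> 5" for m
      using that
    proof (induction m)
      case 0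
      then show ?case using rot[of 0] by (simp add: id_def)
    next
      case (Suc m)
      have "act (\<lambda>j. if j < m then f j else id) 0 \<circ> single m (f m) =
          act (\<lambda>j. (if j < m then f j else id) \<circ> (if j = m then f m else id)) 0"
        unfolding single_def by (rule act_comp_0) (use Suc f in \<open>simp add: permutes_id\<close>)
      also have "\<dots> = act (\<lambda>j. if j < Suc m then f j else id) 0"
        by (rule act_cong) auto
      finally show ?case
        using comp[OF Suc.IH even_single[of "f m" m]] Suc.prems f by simp
    qed
    from this[of 5] have "act (\<lambda>j. if j < 5 then f j else id) 0 \<in> C" by simp
    also have "act (\<lambda>j. if j < 5 then f j else id) 0 = act f 0" by (rule act_cong) simp_all
    finally show ?thesis .
  qed
  have "act f 0 \<in> C"
  proof (cases "odd r")
    case True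
    then show ?thesis using even_act f(1) odd by blast
  next
    case False
    have sa: "sign a = -1" and sb: "sign b = -1"
      using evenperm_cyclic_on[OF a(2,1)] evenperm_cyclic_on[OF b(2,1)] False card
      by (simp_all add: sign_def)
    have perm: "permutation g" if "g permutes {1..p}" for g :: "nat \<Rightarrow> nat"
      using that by (auto simp: permutation_permutes)
    \<comment> \<open>Descending induction on the number \<open>m\<close> of leading columns known
      to be even. At \<open>m = 4\<close> the sign product forces the last column to be even as
      well.\<close>
    have "\<forall>f :: nat \<Rightarrow> nat \<Rightarrow> nat. (\<forall>j<5. f j permutes {1..p}) \<longrightarrow> (\<Prod>j<5. sign (f j)) = 1 \<longrightarrow>
        (\<forall>j<m. evenperm (f j)) \<longrightarrow> act f 0 \<in> C" if "m \<le> 4" for m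
      using that
    proof (induction rule: inc_induct)
      case base
      show ?case
      proof (intro allI impI)
        fix f :: "nat \<Rightarrow> nat \<Rightarrow> nat"
        assume f: "\<forall>j<5. f j permutes {1..p}" "(\<Prod>j<5. sign (f j)) = 1" "\<forall>j<4. evenperm (f j)"
        then have "evenperm (f 4)" by (simp add: prod_lessThan_5 sign_def split: if_splits)
        then have "evenperm (f j)" if "j < 5" for j
          using f(3) that by (cases "j = 4") auto
        then show "act f 0 \<in> C" using even_act f(1) by blast
      qed
    next
      case (step m)
      show ?case
      proof (intro allI impI)
        fix f :: "nat \<Rightarrow> nat \<Rightarrow> nat"
        assume f: "\<forall>j<5. f j permutes {1..p}" "(\<Prod>j<5. sign (f j)) = 1" "\<forall>j<m. evenperm (f j)"
        show "act f 0 \<in> C"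
        proof (cases "evenperm (f m)")
          case True
          then show ?thesis using step f by (auto simp: less_Suc_eq)
        next
          case False
          \<comment> \<open>Both \<open>a\<close> and \<open>b\<close> are odd, so this makes column
            \<open>m\<close> even at the price of flipping the next column; the sign product is kept
            and earlier columns are untouched.\<close>
          let ?f = "\<lambda>j. pair_at m a b j \<circ> f j"
          have m: "m < 4" using step by simp
          have eq: "act (pair_at m a b) 0 \<circ> act f 0 = act ?f 0"
            by (rule act_comp_0) (use f in simp)
          have "act ?f 0 \<in> C"
          proof (rule step.IH[rule_format])
            fix j :: nat assume "j < 5"
            then show "?f j permutes {1..p}" using f pair by (simp add: permutes_compose)
          next
            have "(\<Prod>j<5. sign (?f j)) = (\<Prod>j<5. sign (pair_at m a b j) * sign (f j))"
              by (rule prod.cong) (use f pair in \<open>simp_all add: sign_compose perm\<close>)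
            then show "(\<Prod>j<5. sign (?f j)) = 1"
              using f(2) sa sb by (simp add: prod.distrib prod_sign_pair_at[OF m])
          next
            fix j assume j: "j < Suc m"
            show "evenperm (?f j)"
            proof (cases "j = m")
              case True
              have "\<not> evenperm a" using sa by (auto simp: sign_def)
              then show ?thesis
                using True False f m by (simp add: pair_at_def evenperm_comp perm ap)
            next
              case False
              then show ?thesis using j f by (simp add: pair_at_def)
            qed
          qed
          then have *: "inv' (act (pair_at m a b) 0) \<circ> (act (pair_at m a b) 0 \<circ> act f 0) \<in> C"
            unfolding eq by (intro comp inv abm m)
          have "inv' (act (pair_at m a b) 0) \<circ> act (pair_at m a b) 0 = id"
            by (rule permutes_inv_o(2)[OF act_permutes]) (rule pair)
          then show ?thesis using * by (simp flip: comp_assoc)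
        qed
      qed
    qed
    from this[of 0] show ?thesis using f by simp
  qed
  moreover have "act f k = act f 0 \<circ> act (\<lambda>_. id) k"
    by (simp add: act_comp)
  ultimately show ?thesis by (simp only: comp rot)
qed

end

section \<open>Power groups and the two semidirect decompositions\<close>

lemma group_power_group: "group G \<Longrightarrow> group (power_group G k)"
  unfolding power_group_def by (rule product_group) simp

lemma carrier_power_group: "carrier (power_group G k) = (\<Pi>\<^sub>E i\<in>{..<k}. carrier G)"
  by (simp add: power_group_def)

lemma mult_power_group: "x \<otimes>\<^bsub>power_group G k\<^esub> y = (\<lambda>i\<in>{..<k}. x i \<otimes>\<^bsub>G\<^esub> y i)"
  by (simp add: power_group_def)

lemma subgroup_transposition:
  assumes "{x, y} \<subseteq> {1..p}"
  shows "subgroup {id, Transposition.transpose x y} (sym_group p)"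
proof (rule group.subgroupI[OF sym_group_is_group])
  have "Transposition.transpose x y permutes {1..p}"
    using assms by (intro permutes_swap_id) auto
  then show sub: "{id, Transposition.transpose x y} \<subseteq> carrier (sym_group p)"
    by (simp add: sym_group_carrier permutes_id)
  fix g assume "g \<in> {id, Transposition.transpose x y}"
  then show "inv\<^bsub>sym_group p\<^esub> g \<in> {id, Transposition.transpose x y}"
    using sub by (auto simp: inv_id)
qed (auto simp: sym_group_mult)

text \<open>
  \<open>\<int>\<^sub>2\<^sup>4\<close> is identified with the vectors of even weight in \<open>\<int>\<^sub>2\<^sup>5\<close>; the last coordinate is the sum of
  the others.
\<close>

definition parity_vector :: "(nat \<Rightarrow> int) \<Rightarrow> nat \<Rightarrow> bool" where
  "parity_vector \<epsilon> j = (if j = 4 then odd (\<epsilon> 0 + \<epsilon> 1 + \<epsilon> 2 + \<epsilon> 3) else odd (\<epsilon> j))"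

context five_columns
begin

lemma subgroup_all: "subgroup {f. f permutes {1..p}} (sym_group p)"
  using group.subgroup_self[OF sym_group_is_group, of p] by (simp add: sym_group_def)

text \<open>Even permutations have sign 1, so the sign product is 1 for every family of
  them.\<close>

lemma base_alt_group:
  "base (carrier (alt_group p)) = {act f 0 | f. \<forall>j<5. f j \<in> carrier (alt_group p)}"
proof -
  have "(\<Prod>j<5. sign (f j)) = (1::int)" if "\<forall>j<5. f j \<in> carrier (alt_group p)" for f
    using that by (intro prod.neutral) (auto simp: alt_group_carrier sign_def)
  then show ?thesis unfolding base_def by blast
qed

definition act_alt :: "(nat \<Rightarrow> nat \<Rightarrow> nat) \<Rightarrow> nat \<Rightarrow> nat" where
  "act_alt g = act g 0"

lemma act_alt:
  shows act_alt_hom: "act_alt \<in> hom (power_group (alt_group p) 5) (sym_group (5 * p))"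
    and inj_act_alt: "inj_on act_alt (carrier (power_group (alt_group p) 5))"
    and image_act_alt: "act_alt ` carrier (power_group (alt_group p) 5) = base (carrier (alt_group p))"
proof -
  let ?M = "power_group (alt_group p) 5"
  have M: "g j \<in> carrier (alt_group p)" "g j permutes {1..p}" if "g \<in> carrier ?M" "j < 5" for g j
    using that by (auto simp: carrier_power_group alt_group_carrier PiE_iff)
  show "act_alt \<in> hom ?M (sym_group (5 * p))"
  proof (rule homI)
    fix g assume g: "g \<in> carrier ?M"
    have "act g 0 permutes {1..5 * p}" by (rule act_permutes) (rule M(2)[OF g])
    then show "act_alt g \<in> carrier (sym_group (5 * p))"
      by (simp add: act_alt_def sym_group_carrier)
  next
    fix g h assume g: "g \<in> carrier ?M" and h: "h \<in> carrier ?M"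
    have "act g 0 \<circ> act h 0 = act (\<lambda>j. g j \<circ> h ((j + 4 * 0) mod 5)) (0 + 0)"
      by (rule act_comp) (rule M(2)[OF h])
    also have "\<dots> = act (g \<otimes>\<^bsub>?M\<^esub> h) 0"
      by (rule act_cong) (simp_all add: mult_power_group alt_group_mult)
    finally show "act_alt (g \<otimes>\<^bsub>?M\<^esub> h) = act_alt g \<otimes>\<^bsub>sym_group (5 * p)\<^esub> act_alt h"
      by (simp add: act_alt_def sym_group_mult)
  qed
  show "inj_on act_alt (carrier ?M)"
  proof (rule inj_onI)
    fix g h assume g: "g \<in> carrier ?M" and h: "h \<in> carrier ?M" and eq: "act_alt g = act_alt h"
    have "g j = h j" if "j < 5" for j
      using act_inject(2)[OF eq[unfolded act_alt_def] M(2)[OF g] M(2)[OF h] that] .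
    \<comment> \<open>Outside the five columns both families are \<open>undefined\<close>, since
      members of the product carrier are extensional.\<close>
    moreover have "g j = h j" if "\<not> j < 5" for j
      using g h that by (auto simp: carrier_power_group PiE_def extensional_def)
    ultimately show "g = h" by blast
  qed
  show "act_alt ` carrier ?M = base (carrier (alt_group p))"
    unfolding base_alt_group
  proof (intro equalityI subsetI)
    fix x assume "x \<in> {act f 0 | f. \<forall>j<5. f j \<in> carrier (alt_group p)}"
    then obtain f where f: "x = act f 0" "\<forall>j<5. f j \<in> carrier (alt_group p)" by blast
    have "act_alt (restrict f {..<5}) = x"
      unfolding act_alt_def f(1) by (rule act_cong) simp_all
    moreover have "restrict f {..<5} \<in> carrier ?M"
      using f(2) by (auto simp: carrier_power_group)
    ultimately show "x \<in> act_alt ` carrier ?M" by blast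
  qed (use M(1) in \<open>auto simp: act_alt_def\<close>)
qed

definition act_signs :: "(nat \<Rightarrow> nat) \<Rightarrow> (nat \<Rightarrow> int) \<Rightarrow> nat \<Rightarrow> nat" where
  "act_signs \<tau> \<epsilon> = act (\<lambda>j. if parity_vector \<epsilon> j then \<tau> else id) 0"

text \<open>As \<tau> is an odd involution, choosing \<tau> or the identity in each column turns
  addition modulo 2 into composition, and sign product 1 means an even number of columns with
  \<tau>. Using the same \<tau> in all columns makes the image invariant under shifts.\<close>

lemma act_signs:
  fixes x y :: nat
  defines "\<tau> \<equiv> Transposition.transpose x y"
  assumes xy: "{x, y} \<subseteq> {1..p}" "x \<noteq> y"
  shows act_signs_hom: "act_signs \<tau> \<in> hom (power_group (integer_mod_group 2) 4) (sym_group (5 * p))"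
    and inj_act_signs: "inj_on (act_signs \<tau>) (carrier (power_group (integer_mod_group 2) 4))"
    and image_act_signs: "act_signs \<tau> ` carrier (power_group (integer_mod_group 2) 4) = base {id, \<tau>}"
proof -
  let ?Z = "power_group (integer_mod_group 2) 4"
  have \<tau>: "\<tau> permutes {1..p}" unfolding \<tau>_def using xy by (intro permutes_swap_id) auto
  have \<tau>\<tau>: "\<tau> \<circ> \<tau> = id" unfolding \<tau>_def by simp
  have \<tau>_id: "\<tau> \<noteq> id" unfolding \<tau>_def using xy(2) by (metis id_apply transpose_apply_first)
  have sign: "sign \<tau> = -1" unfolding \<tau>_def using xy(2) by (simp add: sign_swap_id)
  have perm: "(if P then \<tau> else id) permutes {1..p}" for P using \<tau> by (simp add: permutes_id)
  have Z: "\<epsilon> j \<in> {0..<2}" if "\<epsilon> \<in> carrier ?Z" "j < 4" for \<epsilon> j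
    using that by (auto simp: carrier_power_group carrier_integer_mod_group PiE_iff)
  have mult: "parity_vector (\<epsilon> \<otimes>\<^bsub>?Z\<^esub> \<delta>) j \<longleftrightarrow> (parity_vector \<epsilon> j \<noteq> parity_vector \<delta> j)" if "j < 5" for \<epsilon> \<delta> j
    using that by (auto simp: parity_vector_def mult_power_group)
  show "act_signs \<tau> \<in> hom ?Z (sym_group (5 * p))"
  proof (rule homI)
    fix \<epsilon> show "act_signs \<tau> \<epsilon> \<in> carrier (sym_group (5 * p))"
      unfolding act_signs_def sym_group_carrier by (rule act_permutes) (rule perm)
  next
    fix \<epsilon> \<delta>
    have "act_signs \<tau> \<epsilon> \<circ> act_signs \<tau> \<delta> = act (\<lambda>j. (if parity_vector \<epsilon> j then \<tau> else id) \<circ>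
        (if parity_vector \<delta> ((j + 4 * 0) mod 5) then \<tau> else id)) (0 + 0)"
      unfolding act_signs_def by (rule act_comp) (rule perm)
    also have "\<dots> = act_signs \<tau> (\<epsilon> \<otimes>\<^bsub>?Z\<^esub> \<delta>)"
      unfolding act_signs_def by (rule act_cong) (simp_all add: mult \<tau>\<tau>)
    finally show "act_signs \<tau> (\<epsilon> \<otimes>\<^bsub>?Z\<^esub> \<delta>) =
        act_signs \<tau> \<epsilon> \<otimes>\<^bsub>sym_group (5 * p)\<^esub> act_signs \<tau> \<delta>"
      by (simp add: sym_group_mult)
  qed
  show "inj_on (act_signs \<tau>) (carrier ?Z)"
  proof (rule inj_onI)
    fix \<epsilon> \<delta> assume \<epsilon>: "\<epsilon> \<in> carrier ?Z" and \<delta>: "\<delta> \<in> carrier ?Z"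
      and eq: "act_signs \<tau> \<epsilon> = act_signs \<tau> \<delta>"
    have "\<epsilon> j = \<delta> j" if j: "j < 4" for j
    proof -
      have "(if parity_vector \<epsilon> j then \<tau> else id) = (if parity_vector \<delta> j then \<tau> else id)"
        by (rule act_inject(2)[OF eq[unfolded act_signs_def] perm perm]) (use j in simp)
      then have "odd (\<epsilon> j) = odd (\<delta> j)"
        using \<tau>_id j by (auto simp: parity_vector_def split: if_splits)
      moreover have "\<epsilon> j = 0 \<or> \<epsilon> j = 1" "\<delta> j = 0 \<or> \<delta> j = 1"
        using Z[OF \<epsilon> j] Z[OF \<delta> j] by auto
      ultimately show ?thesis by auto
    qed
    moreover have "\<epsilon> j = \<delta> j" if "\<not> j < 4" for j
      using \<epsilon> \<delta> that by (auto simp: carrier_power_group PiE_def extensional_def)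
    ultimately show "\<epsilon> = \<delta>" by blast
  qed
  show "act_signs \<tau> ` carrier ?Z = base {id, \<tau>}"
  proof (intro equalityI subsetI)
    fix g assume "g \<in> act_signs \<tau> ` carrier ?Z"
    then obtain \<epsilon> where \<epsilon>: "g = act_signs \<tau> \<epsilon>" by blast
    show "g \<in> base {id, \<tau>}"
      unfolding \<epsilon> act_signs_def
      by (rule baseI) (simp_all add: prod_lessThan_5 parity_vector_def sign)
  next
    fix g assume "g \<in> base {id, \<tau>}"
    then obtain f where f: "g = act f 0" "\<forall>j<5. f j \<in> {id, \<tau>}" "(\<Prod>j<5. sign (f j)) = 1"
      by (rule baseE)
    define \<epsilon> :: "nat \<Rightarrow> int" where "\<epsilon> = (\<lambda>j\<in>{..<4}. if f j = \<tau> then 1 else 0)"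
    have mem: "\<epsilon> \<in> carrier ?Z"
      by (auto simp: \<epsilon>_def carrier_power_group carrier_integer_mod_group)
    have s: "sign (f j) = (if f j = \<tau> then -1 else 1)" if "j < 5" for j
      using f(2) that sign by auto
    \<comment> \<open>Here sign product 1 enters: the choice in column 4 is determined by the other
      four.\<close>
    have last: "parity_vector \<epsilon> 4 \<longleftrightarrow> f 4 = \<tau>"
      using f(3) unfolding prod_lessThan_5
      by (simp add: s parity_vector_def \<epsilon>_def split: if_splits)
    have "act_signs \<tau> \<epsilon> = g"
      unfolding act_signs_def f(1)
    proof (rule act_cong)
      fix j :: nat assume j: "j < 5"
      have "parity_vector \<epsilon> j \<longleftrightarrow> f j = \<tau>"
      proof (cases "j = 4")
        case False
        then show ?thesis using j by (simp add: parity_vector_def \<epsilon>_def)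
      qed (use last in simp)
      then show "(if parity_vector \<epsilon> j then \<tau> else id) = f j" using f(2) j by auto
    qed simp
    then show "g \<in> act_signs \<tau> ` carrier ?Z" using mem by blast
  qed
qed

lemma wreath_alt_group:
  "\<exists>\<phi> \<in> hom (integer_mod_group 5) (AutoGroup (power_group (alt_group p) 5)).
     sym_group (5 * p)\<lparr>carrier := wreath (carrier (alt_group p))\<rparr> \<cong>
       semidirect_product (power_group (alt_group p) 5) (integer_mod_group 5) \<phi>"
proof -
  have sub: "subgroup (wreath (carrier (alt_group p))) (sym_group (5 * p))"
    by (rule subgroup_wreath[OF alt_group_is_subgroup])
  obtain \<phi> where \<phi>: "\<phi> \<in> hom (integer_mod_group 5) (AutoGroup (power_group (alt_group p) 5))"
    and gr: "group (semidirect_product (power_group (alt_group p) 5) (integer_mod_group 5) \<phi>)"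
    and iso: "(\<lambda>(x, k). act_alt x \<circ> rotation k) \<in>
           iso (semidirect_product (power_group (alt_group p) 5) (integer_mod_group 5) \<phi>)
             (sym_group (5 * p)\<lparr>carrier := wreath (carrier (alt_group p))\<rparr>)"
    by (rule wreath_semidirect_product[OF alt_group_is_subgroup group_power_group[OF alt_group_is_group]
          act_alt_hom inj_act_alt image_act_alt])
  from group.iso_sym[OF gr is_isoI[OF iso]] \<phi> show ?thesis by blast
qed

text \<open>Every permutation is an even one times \<open>id\<close> or a fixed transposition
  \<tau>, according to its sign, so the subgroup A_p^5 has \<open>wreath {id, \<tau>}\<close> as a
  complement, which is itself a semidirect product. The bound on \<open>p\<close> makes room for
  \<tau>.\<close>

lemma wreath_sym_group:
  assumes "p \<ge> 2"
  shows "\<exists>\<psi> \<in> hom (integer_mod_group 5) (AutoGroup (power_group (integer_mod_group 2) 4)).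
      \<exists>\<phi> \<in> hom (semidirect_product (power_group (integer_mod_group 2) 4) (integer_mod_group 5) \<psi>)
             (AutoGroup (power_group (alt_group p) 5)).
        sym_group (5 * p)\<lparr>carrier := wreath {f. f permutes {1..p}}\<rparr> \<cong>
          semidirect_product (power_group (alt_group p) 5)
            (semidirect_product (power_group (integer_mod_group 2) 4) (integer_mod_group 5) \<psi>) \<phi>"
proof -
  define \<tau> where "\<tau> = Transposition.transpose 1 (2::nat)"
  let ?S = "sym_group (5 * p)" and ?W = "wreath {f. f permutes {1..p}}" and ?V = "wreath {id, \<tau>}"
  let ?M = "power_group (alt_group p) 5" and ?Z = "power_group (integer_mod_group 2) 4"
  let ?G = "?S\<lparr>carrier := ?W\<rparr>"
  have xy: "{1, 2} \<subseteq> {1..p}" "1 \<noteq> (2::nat)" using assms by auto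
  have \<tau>: "\<tau> permutes {1..p}" unfolding \<tau>_def using xy by (intro permutes_swap_id) auto
  have \<tau>\<tau>: "\<tau> \<circ> \<tau> = id" unfolding \<tau>_def by simp
  have odd_\<tau>: "\<not> evenperm \<tau>" by (simp add: \<tau>_def evenperm_swap)
  have perm: "permutation f" if "f permutes {1..p}" for f :: "nat \<Rightarrow> nat"
    using that by (auto simp: permutation_permutes)
  have subV: "subgroup {id, \<tau>} (sym_group p)"
    unfolding \<tau>_def by (rule subgroup_transposition[OF xy(1)])
  have Vp: "f permutes {1..p}" if "f \<in> {id, \<tau>}" for f
    using that \<tau> by (auto simp: permutes_id)
  obtain \<psi> where \<psi>: "\<psi> \<in> hom (integer_mod_group 5) (AutoGroup ?Z)"
    and grH: "group (semidirect_product ?Z (integer_mod_group 5) \<psi>)"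
    and isoH: "(\<lambda>(x, k). act_signs \<tau> x \<circ> rotation k) \<in>
           iso (semidirect_product ?Z (integer_mod_group 5) \<psi>) (?S\<lparr>carrier := ?V\<rparr>)"
    using wreath_semidirect_product[OF subV group_power_group[OF group_integer_mod_group]
          act_signs_hom[OF xy, folded \<tau>_def] inj_act_signs[OF xy, folded \<tau>_def]
          image_act_signs[OF xy, folded \<tau>_def]] .
  let ?H = "semidirect_product ?Z (integer_mod_group 5) \<psi>"
  let ?j = "\<lambda>(x, k). act_signs \<tau> x \<circ> rotation k"
  have subW: "subgroup ?W ?S" by (rule subgroup_wreath[OF subgroup_all])
  interpret G: group ?G by (rule group.subgroup_imp_group[OF sym_group_is_group subW])
  have VW: "?V \<subseteq> ?W"
  proof
    fix g assume "g \<in> ?V"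
    then obtain f k where "g = act f k" "\<forall>j<5. f j \<in> {id, \<tau>}" "(\<Prod>j<5. sign (f j)) = 1"
      by (rule wreathE)
    then show "g \<in> ?W" using Vp by (simp add: wreathI)
  qed
  have invG: "inv\<^bsub>?G\<^esub> g = inv' g" if "g \<in> ?W" for g
    using group.m_inv_consistent[OF sym_group_is_group subW that] subgroup.subset[OF subW] that
    by auto
  have baseW: "base (carrier (alt_group p)) \<subseteq> ?W"
  proof
    fix g assume "g \<in> base (carrier (alt_group p))"
    then obtain f where "g = act f 0" "\<forall>j<5. f j \<in> carrier (alt_group p)" "(\<Prod>j<5. sign (f j)) = 1"
      by (rule baseE)
    then show "g \<in> ?W" by (simp add: wreathI alt_group_carrier)
  qed
  have jV: "?j ` carrier ?H = ?V" using isoH by (auto simp: iso_def bij_betw_def)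
  have grM: "group ?M" by (rule group_power_group[OF alt_group_is_group])
  have conj_alt: "f \<circ> g \<circ> inv' f \<in> carrier (alt_group p)"
    if f: "f permutes {1..p}" and g: "g \<in> carrier (alt_group p)" for f g
  proof -
    have pg: "g permutes {1..p}" using g by (simp add: alt_group_carrier)
    have "evenperm (f \<circ> g \<circ> inv' f)"
      using g evenperm_comp[OF permutation_compose[OF perm[OF f] perm[OF pg]] permutation_inverse[OF perm[OF f]]]
        evenperm_comp[OF perm[OF f] perm[OF pg]] evenperm_inv[OF perm[OF f]]
      by (simp add: alt_group_carrier)
    then show ?thesis
      using f pg by (simp add: alt_group_carrier permutes_compose permutes_inv)
  qed
  obtain \<phi> where \<phi>: "\<phi> \<in> hom ?H (AutoGroup ?M)" and gr: "group (semidirect_product ?M ?H \<phi>)"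
    and iso: "(\<lambda>(x, h). act_alt x \<otimes>\<^bsub>?G\<^esub> ?j h) \<in> iso (semidirect_product ?M ?H \<phi>) ?G"
  proof (rule G.internal_semidirect_product[OF grM grH, where i = act_alt and j = ?j])
    show "act_alt \<in> hom ?M ?G"
      using act_alt_hom image_act_alt baseW by (auto simp: hom_def)
    show "?j \<in> hom ?H ?G"
      using isoH VW by (auto simp: iso_def hom_def)
    show "inj_on ?j (carrier ?H)" using isoH by (auto simp: iso_def bij_betw_def)
  next
    fix x h assume x: "x \<in> carrier ?M" and h: "h \<in> carrier ?H"
    obtain g where g: "act_alt x = act g 0" "\<forall>j<5. g j \<in> carrier (alt_group p)"
      using imageI[OF x, of act_alt] unfolding image_act_alt by (elim baseE)
    have "?j h \<in> ?V" using jV h by blast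
    then obtain v k where v: "?j h = act v k" "\<forall>j<5. v j \<in> {id, \<tau>}" by (rule wreathE)
    have vp: "v j permutes {1..p}" if "j < 5" for j using v(2) that Vp by blast
    have gp: "g j permutes {1..p}" "evenperm (g j)" if "j < 5" for j
      using g(2) that by (auto simp: alt_group_carrier)
    have conj_vg: "\<forall>j<5. v j \<circ> g ((j + 4 * k) mod 5) \<circ> inv' (v j) \<in> carrier (alt_group p)"
    proof (intro allI impI)
      fix j :: nat assume "j < 5"
      show "v j \<circ> g ((j + 4 * k) mod 5) \<circ> inv' (v j) \<in> carrier (alt_group p)"
        by (rule conj_alt[OF vp[OF \<open>j < 5\<close>]]) (use g(2) in simp)
    qed
    \<comment> \<open>Shifting by \<open>k\<close> and back leaves the even permutation from column
      j - k conjugated by \<open>v j\<close>, which is again even.\<close>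
    have "act v k \<circ> act g 0 \<circ> inv' (act v k) =
        act (\<lambda>j. v j \<circ> g ((j + 4 * k) mod 5) \<circ> inv' (v (((j + 4 * k) mod 5 + k) mod 5))) (k + 0 + 4 * k)"
      by (simp add: inv_act vp act_comp gp permutes_inv add.assoc)
    also have "\<dots> = act (\<lambda>j. v j \<circ> g ((j + 4 * k) mod 5) \<circ> inv' (v j)) 0"
      by (rule act_cong) (simp_all add: mod_5_shift_back(1))
    also have "\<dots> \<in> base (carrier (alt_group p))"
      unfolding base_alt_group using conj_vg by blast
    finally have "?j h \<circ> act_alt x \<circ> inv' (?j h) \<in> act_alt ` carrier ?M"
      unfolding image_act_alt g(1) v(1) .
    moreover have "?j h \<in> ?W" using jV h VW by blast
    ultimately show "?j h \<otimes>\<^bsub>?G\<^esub> act_alt x \<otimes>\<^bsub>?G\<^esub> inv\<^bsub>?G\<^esub> (?j h) \<in> act_alt ` carrier ?M"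
      by (simp only: invG) (simp add: sym_group_mult)
  next
    show "act_alt ` carrier ?M \<inter> ?j ` carrier ?H \<subseteq> {\<one>\<^bsub>?G\<^esub>}"
      unfolding image_act_alt jV
    proof
      fix g assume g: "g \<in> base (carrier (alt_group p)) \<inter> ?V"
      then obtain f where f: "g = act f 0" "\<forall>j<5. f j \<in> carrier (alt_group p)"
        by (meson IntD1 baseE)
      obtain v k where v: "g = act v k" "\<forall>j<5. v j \<in> {id, \<tau>}"
        using g by (meson IntD2 wreathE)
      have eq: "act f 0 = act v k" using f v by simp
      have "g = act (\<lambda>_. id) 0"
        unfolding f(1)
      proof (rule act_cong)
        fix j :: nat assume j: "j < 5"
        \<comment> \<open>The two descriptions of \<open>g\<close> agree column by column, and the
          only even element of \<open>{id, \<tau>}\<close> is \<open>id\<close>.\<close>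
        have "f j = v j"
          by (rule act_inject(2)[OF eq _ _ j]) (use f v Vp in \<open>auto simp: alt_group_carrier\<close>)
        moreover have "evenperm (f j)" using f(2) j by (simp add: alt_group_carrier)
        moreover have "v j = id \<or> v j = \<tau>" using v(2) j by simp
        ultimately show "f j = id" using odd_\<tau> by auto
      qed simp
      then show "g \<in> {\<one>\<^bsub>?G\<^esub>}" by (simp add: act_id sym_group_one)
    qed
  next
    fix g assume "g \<in> carrier ?G"
    then obtain f k where f: "g = act f k" "\<forall>j<5. f j \<in> {f. f permutes {1..p}}" "(\<Prod>j<5. sign (f j)) = 1"
      by (auto elim: wreathE)
    \<comment> \<open>\<open>v j\<close> has the sign of \<open>f j\<close>, so
      \<open>f j \<circ> v j\<close> is even; as \<open>v j\<close> is its own inverse,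
      \<open>g\<close> is this even part times \<open>act v k\<close>.\<close>
    define v where "v j = (if evenperm (f j) then id else \<tau>)" for j
    have vp: "v j permutes {1..p}" for j using \<tau> by (simp add: v_def permutes_id)
    have vv: "v j \<circ> v j = id" for j using \<tau>\<tau> by (simp add: v_def)
    have "sign (v j) = sign (f j)" for j using odd_\<tau> by (simp add: v_def sign_def)
    then have "act v k \<in> ?V" using f(3) by (intro wreathI) (simp_all add: v_def)
    then have "act v k \<in> ?j ` carrier ?H" unfolding jV .
    then obtain h where h: "act v k = ?j h" "h \<in> carrier ?H" by (rule imageE)
    have "\<forall>j<5. f j \<circ> v j \<in> carrier (alt_group p)"
    proof (intro allI impI)
      fix j :: nat assume "j < 5"
      then have fp: "f j permutes {1..p}" using f(2) by simp
      then have "evenperm (f j \<circ> v j)"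
        using odd_\<tau> \<tau> by (simp add: evenperm_comp perm v_def)
      then show "f j \<circ> v j \<in> carrier (alt_group p)"
        using fp vp by (simp add: alt_group_carrier permutes_compose)
    qed
    then have "act (\<lambda>j. f j \<circ> v j) 0 \<in> base (carrier (alt_group p))"
      unfolding base_alt_group by blast
    then have "act (\<lambda>j. f j \<circ> v j) 0 \<in> act_alt ` carrier ?M" unfolding image_act_alt .
    then obtain x where x: "act (\<lambda>j. f j \<circ> v j) 0 = act_alt x" "x \<in> carrier ?M"
      by (rule imageE)
    have "act (\<lambda>j. f j \<circ> v j) 0 \<circ> act v k = act (\<lambda>j. f j \<circ> v j \<circ> v ((j + 4 * 0) mod 5)) (0 + k)"
      by (rule act_comp) (rule vp)
    also have "\<dots> = g"
      unfolding f(1) by (rule act_cong) (simp_all add: comp_assoc vv)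
    finally show "\<exists>x\<in>carrier ?M. \<exists>h\<in>carrier ?H. g = act_alt x \<otimes>\<^bsub>?G\<^esub> ?j h"
      using x h by (intro bexI[of _ x] bexI[of _ h]) (simp_all add: sym_group_mult)
  qed (rule inj_act_alt)
  from group.iso_sym[OF gr is_isoI[OF iso]] \<psi> \<phi> show ?thesis by blast
qed


text \<open>An \<open>r\<close>-cycle is even exactly when \<open>r\<close> is odd, which decides
  the column group; \<open>a\<close> and \<open>b\<close> have equal sign, so the generators meet
  the sign condition in both cases. Invertibility of \<open>d\<close> modulo 5 makes every shift a
  power of the given one.\<close>

lemma generate_meeting_cycles:
  assumes a: "a permutes A" "cyclic_on a A" and b: "b permutes B" "cyclic_on b B"
    and AB: "A \<inter> B = {z}" "A \<union> B = {1..p}" and card: "card A = r" "card B = r" "r \<ge> 2"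
    and d: "(d * e) mod 5 = 1"
  shows "generate (sym_group (5 * p)) {act (pair_at 0 a b) 0, act (\<lambda>_. id) d} =
           wreath (if odd r then carrier (alt_group p) else {f. f permutes {1..p}})"
    (is "generate ?S ?gens = wreath ?U")
proof -
  interpret S: group ?S by (rule sym_group_is_group)
  have ap: "a permutes {1..p}" and bp: "b permutes {1..p}"
    using a(1) b(1) AB(2) by (auto intro: permutes_subset)
  have pair: "pair_at m a b j permutes {1..p}" for m j
    by (simp add: pair_at_def ap bp permutes_id)
  have even_ab: "evenperm a \<longleftrightarrow> odd r" "evenperm b \<longleftrightarrow> odd r"
    using evenperm_cyclic_on[OF a(2,1)] evenperm_cyclic_on[OF b(2,1)] card by simp_all
  have gens: "?gens \<subseteq> carrier ?S"
    using act_permutes[of "pair_at 0 a b", OF pair] act_permutes[of "\<lambda>_. id", OF permutes_id]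
    by (simp add: sym_group_carrier)
  have sub_gen: "subgroup (generate ?S ?gens) ?S" by (rule S.generate_is_subgroup[OF gens])
  have sub_U: "subgroup ?U (sym_group p)"
    using alt_group_is_subgroup subgroup_all by simp
  show ?thesis
  proof
    have "act (pair_at 0 a b) 0 \<in> wreath ?U"
    proof (rule wreathI)
      fix j :: nat
      show "pair_at 0 a b j \<in> ?U"
        using pair even_ab by (simp add: alt_group_carrier pair_at_def)
    next
      have "sign a * sign b = 1" using even_ab by (simp add: sign_def)
      then show "(\<Prod>j<5. sign (pair_at 0 a b j)) = 1" by (simp add: prod_sign_pair_at)
    qed
    moreover have "act (\<lambda>_. id) d \<in> wreath ?U"
      using subgroup.one_closed[OF sub_U] by (intro wreathI) (simp_all add: sym_group_one)
    ultimately show "generate ?S ?gens \<subseteq> wreath ?U"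
      by (intro S.generate_subgroup_incl subgroup_wreath sub_U) simp
  next
    have rot_mult: "act (\<lambda>_. id) (m * d) \<in> generate ?S ?gens" for m
    proof (induction m)
      case 0
      have "act (\<lambda>_. id) 0 \<in> generate ?S ?gens"
        unfolding act_id using subgroup.one_closed[OF sub_gen] by (simp only: sym_group_one)
      then show ?case by (simp only: mult_0)
    next
      case (Suc m)
      have "act (\<lambda>_. id) d \<in> generate ?S ?gens" by (rule generate.incl) simp
      from subgroup.m_closed[OF sub_gen this Suc]
      have "act (\<lambda>_. id) d \<circ> act (\<lambda>_. id) (m * d) \<in> generate ?S ?gens"
        by (simp only: sym_group_mult)
      moreover have "act (\<lambda>_. id) d \<circ> act (\<lambda>_. id) (m * d) = act (\<lambda>_. id \<circ> id) (d + m * d)"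
        by (rule act_comp) (rule permutes_id)
      ultimately show ?case by (simp only: mult_Suc comp_id)
    qed
    have rot: "act (\<lambda>_. id) k \<in> generate ?S ?gens" for k
    proof -
      \<comment> \<open>As \<open>e\<close> inverts \<open>d\<close>, the shift by \<open>k\<close>
        is the (k e)-th power of the shift by \<open>d\<close>.\<close>
      have "(k * e * d) mod 5 = (k * ((d * e) mod 5)) mod 5"
        by (simp add: mod_mult_right_eq ac_simps)
      then have "act (\<lambda>_. id) (k * e * d) = act (\<lambda>_. id) k"
        using d by (intro act_cong) simp_all
      then show ?thesis using rot_mult[of "k * e"] by simp
    qed
    show "wreath ?U \<subseteq> generate ?S ?gens"
    proof
      fix g assume "g \<in> wreath ?U"
      then obtain f k where f: "g = act f k" "\<forall>j<5. f j \<in> ?U" "(\<Prod>j<5. sign (f j)) = 1"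
        by (rule wreathE)
      show "g \<in> generate ?S ?gens"
        unfolding f(1)
      proof (rule act_mem_of_meeting_cycles[OF sub_gen a b AB card rot _ _ f(3)])
        show "act (pair_at 0 a b) 0 \<in> generate ?S ?gens" by (rule generate.incl) simp
        show "f j permutes {1..p}" if "j < 5" for j
          using f(2) that by (simp add: alt_group_carrier split: if_splits)
        show "\<forall>j<5. evenperm (f j)" if "odd r"
          using f(2) that by (simp add: alt_group_carrier)
      qed
    qed
  qed
qed

end

section \<open>Trees with two hubs\<close>

lemma ex_inverse_mod_5:
  fixes d :: nat
  assumes "d < 5" "d \<noteq> 0"
  obtains e where "(d * e) mod 5 = 1"
proof -
  have "d = 1 \<or> d = 2 \<or> d = 3 \<or> d = 4" using assms by auto
  then have "(d * 1) mod 5 = 1 \<or> (d * 2) mod 5 = 1 \<or> (d * 3) mod 5 = 1 \<or> (d * 4) mod 5 = 1"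
    by auto
  then show thesis using that by blast
qed

lemma card_filter_passport:
  assumes "finite A" "image_mset f (mset_set A) = M"
  shows "card {x \<in> A. f x = y} = count M y"
  using assms by (auto simp: count_image_mset' intro!: arg_cong[where f = card])

context
  fixes T :: "'v bicolored_map"
  assumes T: "bicolored_plane_tree T"
begin

lemma
  shows finite_black: "finite (black T)" and finite_white: "finite (white T)"
    and disjoint: "black T \<inter> white T = {}" and edges_subset: "edges T \<subseteq> black T \<times> white T"
  using T by (auto simp: bicolored_plane_tree_def)

lemma incident_black: "b \<in> black T \<Longrightarrow> incident T b = {e \<in> edges T. fst e = b}"
  using disjoint edges_subset by (fastforce simp: incident_def)

lemma incident_white: "w \<in> white T \<Longrightarrow> incident T w = {e \<in> edges T. snd e = w}"
  using disjoint edges_subset by (fastforce simp: incident_def)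

lemma cyclic_rot: "v \<in> black T \<union> white T \<Longrightarrow> vertex_degree T v > 0 \<Longrightarrow> cyclic_on (rot T v) (incident T v)"
proof -
  assume v: "v \<in> black T \<union> white T" and "vertex_degree T v > 0"
  then have "incident T v \<noteq> {}" by (auto simp: vertex_degree_def)
  then show ?thesis using T v by (simp add: bicolored_plane_tree_def)
qed

text \<open>Otherwise \<open>b\<close>, \<open>w\<close>, \<open>b'\<close>, \<open>w'\<close> would
  form a cycle of length 4.\<close>

lemma common_neighbours_eq:
  assumes "(b, w) \<in> edges T" "(b, w') \<in> edges T" "(b', w) \<in> edges T" "(b', w') \<in> edges T" "b \<noteq> b'"
  shows "w = w'"
proof (rule ccontr)
  assume "w \<noteq> w'"
  then have "distinct [b, w, b', w']"
    using assms edges_subset disjoint by auto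
  moreover have "successively (adjacent T) [b, w, b', w']" "adjacent T (last [b, w, b', w']) (hd [b, w, b', w'])"
    using assms by (simp_all add: adjacent_def)
  moreover have "length [b, w, b', w'] \<ge> 3" by simp
  ultimately show False
    using T unfolding bicolored_plane_tree_def acyclic_map_def by blast
qed


text \<open>As \<open>r\<close> differs from 1, it occurs exactly twice among the black
  degrees.\<close>

lemma two_hubs:
  assumes "image_mset (vertex_degree T) (mset_set (black T)) = replicate_mset 2 r + replicate_mset s 1"
    and "r \<ge> 2"
  obtains b1 b2 where "b1 \<noteq> b2" "{b1, b2} \<subseteq> black T" "vertex_degree T b1 = r" "vertex_degree T b2 = r"
    "\<forall>b \<in> black T - {b1, b2}. vertex_degree T b = 1"
proof -
  have "card {b \<in> black T. vertex_degree T b = r} = 2"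
    unfolding card_filter_passport[OF finite_black assms(1)] using assms(2) by simp
  then obtain b1 b2 where b: "{b \<in> black T. vertex_degree T b = r} = {b1, b2}" "b1 \<noteq> b2"
    by (auto simp: card_2_iff)
  have deg: "vertex_degree T b = r \<or> vertex_degree T b = 1" if "b \<in> black T" for b
  proof -
    have "vertex_degree T b \<in># image_mset (vertex_degree T) (mset_set (black T))"
      using that finite_black by simp
    then show ?thesis unfolding assms(1) by (auto split: if_splits)
  qed
  show thesis by (rule that[OF b(2)]) (use b(1) deg in blast)+
qed

lemma rot_leaf:
  assumes "v \<in> black T \<union> white T" "vertex_degree T v = 1" "e \<in> incident T v"
  shows "rot T v e = e"
proof -
  from assms(2,3) have "incident T v = {e}"
    unfolding vertex_degree_def by (metis card_1_singletonE singletonD)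
  then show ?thesis
    using cyclic_on_inI[OF cyclic_rot[OF assms(1)] assms(3)] assms(2) by simp
qed

text \<open>The rotation at \<open>b\<close> transported to rows: an edge at \<open>b\<close> is
  determined by its white end, which \<omega> numbers.\<close>

definition hub_rot :: "(nat \<Rightarrow> 'v) \<Rightarrow> nat \<Rightarrow> 'v \<Rightarrow> nat \<Rightarrow> nat" where
  "hub_rot \<omega> p b x =
     (if x \<in> {1..p} \<and> (b, \<omega> x) \<in> edges T
      then inv_into {1..p} \<omega> (snd (rot T b (b, \<omega> x))) else x)"

text \<open>Passing from an edge at \<open>b\<close> to the number of its white end is injective and
  intertwines \<open>rot T b\<close> with \<open>hub_rot\<close>, so cyclicity and the degree carry
  over.\<close>

lemma hub_rot:
  assumes \<omega>: "bij_betw \<omega> {1..p} (white T)" and b: "b \<in> black T" "vertex_degree T b > 0"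
  defines "A \<equiv> {x \<in> {1..p}. (b, \<omega> x) \<in> edges T}"
  shows cyclic_on_hub_rot: "cyclic_on (hub_rot \<omega> p b) A"
    and hub_rot_permutes: "hub_rot \<omega> p b permutes A"
    and card_hub_rot: "card A = vertex_degree T b"
    and hub_rot_edge: "x \<in> A \<Longrightarrow> rot T b (b, \<omega> x) = (b, \<omega> (hub_rot \<omega> p b x)) \<and> hub_rot \<omega> p b x \<in> A"
proof -
  let ?h = "\<lambda>e. inv_into {1..p} \<omega> (snd e)"
  have w: "snd e \<in> white T" "e = (b, snd e)" if "e \<in> incident T b" for e
    using that incident_black[OF b(1)] edges_subset by auto
  have h: "?h e \<in> {1..p}" "\<omega> (?h e) = snd e" if "e \<in> incident T b" for e
    using bij_betw_apply[OF bij_betw_inv_into[OF \<omega>] w(1)[OF that]]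
      bij_betw_inv_into_right[OF \<omega> w(1)[OF that]] by simp_all
  have A: "A = ?h ` incident T b"
  proof (intro equalityI subsetI)
    fix x assume x: "x \<in> A"
    then have "?h (b, \<omega> x) = x" using \<omega> by (auto simp: A_def bij_betw_def)
    moreover have "(b, \<omega> x) \<in> incident T b" using x by (simp add: A_def incident_black[OF b(1)])
    ultimately show "x \<in> ?h ` incident T b" by (metis imageI)
  next
    fix x assume "x \<in> ?h ` incident T b"
    then obtain e where e: "e \<in> incident T b" "x = ?h e" by blast
    then have "(b, \<omega> x) = e" using h(2)[OF e(1)] w(2)[OF e(1)] by simp
    then show "x \<in> A" using e h(1)[OF e(1)] by (simp add: A_def incident_def)
  qed
  have cyc: "cyclic_on (rot T b) (incident T b)" using b by (intro cyclic_rot) auto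
  have step: "hub_rot \<omega> p b (?h e) = ?h (rot T b e)" if e: "e \<in> incident T b" for e
  proof -
    have "(b, \<omega> (?h e)) = e" using h(2)[OF e] w(2)[OF e] by simp
    moreover have "e \<in> edges T" using e by (simp add: incident_def)
    ultimately show ?thesis using h(1)[OF e] by (simp add: hub_rot_def)
  qed
  show cyc_A: "cyclic_on (hub_rot \<omega> p b) A"
    unfolding A by (rule cyclic_on_image[OF cyc]) (rule step)
  show "hub_rot \<omega> p b permutes A"
    by (rule cyclic_on_permutes[OF cyc_A]) (auto simp: hub_rot_def A_def)
  have "inj_on ?h (incident T b)"
    by (rule inj_onI) (metis h(2) w(2))
  then show "card A = vertex_degree T b"
    unfolding A by (simp add: card_image vertex_degree_def)
  assume x: "x \<in> A"
  then have e: "(b, \<omega> x) \<in> incident T b" by (simp add: A_def incident_black[OF b(1)])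
  have "?h (b, \<omega> x) = x" using x \<omega> by (auto simp: A_def bij_betw_def)
  with step[OF e] have hx: "hub_rot \<omega> p b x = ?h (rot T b (b, \<omega> x))" by simp
  have re: "rot T b (b, \<omega> x) \<in> incident T b" by (rule cyclic_on_inI[OF cyc e])
  show "rot T b (b, \<omega> x) = (b, \<omega> (hub_rot \<omega> p b x)) \<and> hub_rot \<omega> p b x \<in> A"
    using h(2)[OF re] w(2)[OF re] cyclic_on_inI[OF cyc_A x] by (simp add: hx)
qed

end

text \<open>The hubs send r + r = p + 1 edges to p white vertices, so they share a neighbour, and
  only one because the tree is acyclic. Hence every white vertex is adjacent to a hub, which fixes
  where its columns start.\<close>

lemma two_hub_tree_columns:
  fixes T :: "'v bicolored_map" and lab :: "'v \<times> 'v \<Rightarrow> nat"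
  assumes T: "bicolored_plane_tree T"
    and black: "image_mset (vertex_degree T) (mset_set (black T)) = replicate_mset 2 r + replicate_mset s 1"
    and white: "image_mset (vertex_degree T) (mset_set (white T)) = replicate_mset p 5"
    and n: "card (edges T) = 5 * p" and p: "p + 1 = 2 * r" and r: "r \<ge> 2"
    and lab: "edge_labelling T lab"
  obtains \<theta> a b A B z d e where "five_columns p \<theta>"
    "a permutes A" "cyclic_on a A" "b permutes B" "cyclic_on b B"
    "A \<inter> B = {z}" "A \<union> B = {1..p}" "card A = r" "card B = r" "(d * e) mod 5 = 1"
    "sigma0 T lab = five_columns.act p \<theta> (pair_at 0 a b) 0"
    "sigma1 T lab = five_columns.act p \<theta> (\<lambda>_. id) d"
proof -
  note fin = finite_black[OF T] finite_white[OF T]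
  note edges_bw = edges_subset[OF T]
  have labbij: "bij_betw lab (edges T) {1..5 * p}"
    using lab n by (simp add: edge_labelling_def)
  have fin_e: "finite (edges T)" using edges_bw fin by (meson finite_SigmaI finite_subset)
  have card_W: "card (white T) = p"
    using arg_cong[OF white, of size] by simp
  have deg_w: "vertex_degree T w = 5" if "w \<in> white T" for w
  proof -
    have "vertex_degree T w \<in># image_mset (vertex_degree T) (mset_set (white T))"
      using that fin by simp
    then show ?thesis unfolding white by (auto split: if_splits)
  qed
  obtain b1 b2 where "b1 \<noteq> b2" "{b1, b2} \<subseteq> black T"
    and deg: "vertex_degree T b1 = r" "vertex_degree T b2 = r"
      "\<forall>b \<in> black T - {b1, b2}. vertex_degree T b = 1"
    by (rule two_hubs[OF T black r])
  then have b12: "b1 \<noteq> b2" "b1 \<in> black T" "b2 \<in> black T" by simp_all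
  obtain \<omega> where \<omega>: "bij_betw \<omega> {1..p} (white T)"
    using ex_bij_betw_nat_finite_1[OF fin(2)] card_W by auto
  have \<omega>W: "\<omega> x \<in> white T" if "x \<in> {1..p}" for x
    using bij_betw_apply[OF \<omega> that] .
  have \<omega>_eq: "x = y" if "\<omega> x = \<omega> y" "x \<in> {1..p}" "y \<in> {1..p}" for x y
    using \<omega> that by (auto simp: bij_betw_def dest: inj_onD)
  define A where "A = {x \<in> {1..p}. (b1, \<omega> x) \<in> edges T}"
  define B where "B = {x \<in> {1..p}. (b2, \<omega> x) \<in> edges T}"
  define a where "a = hub_rot T \<omega> p b1"
  define b where "b = hub_rot T \<omega> p b2"
  have r0: "vertex_degree T b1 > 0" "vertex_degree T b2 > 0" using deg r by auto
  note A = hub_rot[OF T \<omega> b12(2) r0(1), folded A_def a_def, unfolded deg(1)]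
  note B = hub_rot[OF T \<omega> b12(3) r0(2), folded B_def b_def, unfolded deg(2)]
  have AB_sub: "A \<union> B \<subseteq> {1..p}" by (auto simp: A_def B_def)
  have fin_AB: "finite A" "finite B" using finite_cyclic_on[OF A(1)] finite_cyclic_on[OF B(1)] by auto
  have card_Un: "card (A \<union> B) + card (A \<inter> B) = 2 * r"
    using card_Un_Int[OF fin_AB] A(3) B(3) by simp
  have card_le: "card (A \<union> B) \<le> p"
    using card_mono[OF _ AB_sub] by simp
  have "card (A \<inter> B) \<noteq> 0" using card_Un card_le p by linarith
  then have "A \<inter> B \<noteq> {}" by (metis card.empty)
  then obtain z where z: "z \<in> A" "z \<in> B" by blast
  have AB: "A \<inter> B = {z}"
  proof -
    have "x = z" if "x \<in> A" "x \<in> B" for x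
    proof (rule \<omega>_eq)
      show "\<omega> x = \<omega> z"
        by (rule common_neighbours_eq[OF T, of b1 _ _ b2]) (use that z b12 in \<open>simp_all add: A_def B_def\<close>)
    qed (use that z in \<open>simp_all add: A_def\<close>)
    with z show ?thesis by blast
  qed
  have AB_Un: "A \<union> B = {1..p}"
    by (rule card_subset_eq) (use AB_sub card_Un AB p in simp_all)
  define R where "R w = rot T w" for w
  have inc: "incident T w = {e \<in> edges T. snd e = w}" if "w \<in> white T" for w
    by (rule incident_white[OF T that])
  have cyc: "cyclic_on (R w) (incident T w)" if "w \<in> white T" for w
    unfolding R_def by (rule cyclic_rot[OF T]) (use that deg_w in auto)
  have card5: "card (incident T w) = 5" if "w \<in> white T" for w
    using deg_w[OF that] by (simp add: vertex_degree_def)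
  have R5: "(R w ^^ 5) e = e" if "w \<in> white T" "e \<in> incident T w" for w e
    using cyclic_on_bij_betw_funpow(2)[OF cyc[OF that(1)] that(2)] card5[OF that(1)] by simp
  have R_in: "(R w ^^ i) e \<in> incident T w" if "w \<in> white T" "e \<in> incident T w" for w e i
    by (rule cyclic_on_funpow_in[OF cyc[OF that(1)] that(2)])
  have R_eq: "(R w ^^ i) e = (R w ^^ j) e \<longleftrightarrow> i mod 5 = j mod 5"
    if "w \<in> white T" "e \<in> incident T w" for w e i j
    by (rule funpow_cyclic_on_eq_iff[OF cyc[OF that(1)] that(2) card5[OF that(1)]]) simp
  have zW: "\<omega> z \<in> white T" using z \<omega>W by (simp add: A_def)
  have z_inc: "(b1, \<omega> z) \<in> incident T (\<omega> z)" "(b2, \<omega> z) \<in> incident T (\<omega> z)"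
    using z by (simp_all add: A_def B_def inc[OF zW])
  have "(b2, \<omega> z) \<in> (\<lambda>i. (R (\<omega> z) ^^ i) (b1, \<omega> z)) ` {..<5}"
    using cyclic_on_bij_betw_funpow(1)[OF cyc[OF zW] z_inc(1)] z_inc(2) card5[OF zW]
    by (simp add: bij_betw_def)
  \<comment> \<open>\<open>e\<close> counts the turns from the \<open>b1\<close> edge to the
    \<open>b2\<close> edge at the common white vertex. It is nonzero modulo 5, hence has an inverse
    \<open>d\<close>.\<close>
  then obtain e where e: "e < 5" "(R (\<omega> z) ^^ e) (b1, \<omega> z) = (b2, \<omega> z)" by auto
  have "e \<noteq> 0" using e(2) b12(1) by (cases e) auto
  then obtain d where ed: "(e * d) mod 5 = 1" using ex_inverse_mod_5[OF e(1)] by blast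
  \<comment> \<open>Each white vertex gets a reference edge such that \<open>b1\<close> is met in column 0 and \<open>b2\<close> in
    column 1, where passing to the next column means turning by \<open>e\<close> steps.\<close>
  define e0 where "e0 x = (if x \<in> A then (b1, \<omega> x) else (R (\<omega> x) ^^ (5 - e)) (b2, \<omega> x))" for x
  define E where "E x i = (R (\<omega> x) ^^ (e * i)) (e0 x)" for x i
  have e0_inc: "e0 x \<in> incident T (\<omega> x)" if x: "x \<in> {1..p}" for x
  proof (cases "x \<in> A")
    case True
    then show ?thesis using inc[OF \<omega>W[OF x]] by (simp add: e0_def A_def)
  next
    case False
    then have "x \<in> B" using AB_Un x by blast
    then have "(b2, \<omega> x) \<in> incident T (\<omega> x)" using inc[OF \<omega>W[OF x]] by (simp add: B_def)
    then show ?thesis using False R_in[OF \<omega>W[OF x]] by (simp add: e0_def)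
  qed
  have E_inc: "E x i \<in> incident T (\<omega> x)" if "x \<in> {1..p}" for x i
    unfolding E_def by (rule R_in[OF \<omega>W[OF that] e0_inc[OF that]])
  have E_edge: "E x i \<in> edges T" "snd (E x i) = \<omega> x" if "x \<in> {1..p}" for x i
    using E_inc[OF that] inc[OF \<omega>W[OF that]] by simp_all
  have E_A: "E x 0 = (b1, \<omega> x)" if "x \<in> A" for x
    using that by (simp add: E_def e0_def)
  have E_B: "E x 1 = (b2, \<omega> x)" if "x \<in> B" for x
  proof (cases "x \<in> A")
    case True
    then have "x = z" using that AB by blast
    then show ?thesis using e(2) z by (simp add: E_def e0_def)
  next
    case False
    have x: "x \<in> {1..p}" using that by (simp add: B_def)
    have "(b2, \<omega> x) \<in> incident T (\<omega> x)" using that inc[OF \<omega>W[OF x]] by (simp add: B_def)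
    \<comment> \<open>Turning by \<open>5 - e\<close> and then by \<open>e\<close> is a full turn
      around a vertex of degree 5.\<close>
    from R5[OF \<omega>W[OF x] this] have "(R (\<omega> x) ^^ (e + (5 - e))) (b2, \<omega> x) = (b2, \<omega> x)"
      using e(1) by simp
    then show ?thesis using False by (simp add: E_def e0_def funpow_add)
  qed
  \<comment> \<open>One turn equals \<open>d\<close> column steps, because a column step is
    \<open>e\<close> turns and \<open>e * d\<close> is 1 modulo 5.\<close>
  have E_shift: "R (\<omega> x) (E x i) = E x ((i + d) mod 5)" if x: "x \<in> {1..p}" for x i
  proof -
    have "(e * ((i + d) mod 5)) mod 5 = (e * i + e * d) mod 5"
      by (simp add: mod_mult_right_eq distrib_left)
    also have "\<dots> = (e * i + 1) mod 5"
      using ed by (intro mod_add_cong refl) simp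
    finally have "(R (\<omega> x) ^^ Suc (e * i)) (e0 x) = (R (\<omega> x) ^^ (e * ((i + d) mod 5))) (e0 x)"
      unfolding R_eq[OF \<omega>W[OF x] e0_inc[OF x]] by simp
    then show ?thesis by (simp add: E_def)
  qed
  have E_inj: "x = y \<and> i = j" if "E x i = E y j" "x \<in> {1..p}" "y \<in> {1..p}" "i < 5" "j < 5" for x y i j
  proof -
    have xy: "x = y" by (rule \<omega>_eq) (use that E_edge(2) in metis)+
    then have "(e * i) mod 5 = (e * j) mod 5"
      using that(1) R_eq[OF \<omega>W e0_inc, OF that(2,2)] by (simp add: E_def)
    then have "(d * ((e * i) mod 5)) mod 5 = (d * ((e * j) mod 5)) mod 5" by simp
    then have "((e * d) mod 5 * i) mod 5 = ((e * d) mod 5 * j) mod 5"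
      by (simp add: mod_mult_right_eq mod_mult_left_eq ac_simps)
    then show ?thesis using xy that(4,5) ed by simp
  qed
  have E_bij: "bij_betw (\<lambda>(x, i). E x i) ({1..p} \<times> {..<5}) (edges T)"
  proof -
    have inj: "inj_on (\<lambda>(x, i). E x i) ({1..p} \<times> {..<5})"
      using E_inj by (fastforce simp: inj_on_def)
    \<comment> \<open>Surjectivity is a count: the \<open>E x i\<close> are \<open>5 * p\<close>
      distinct edges, as many as the tree has.\<close>
    have "(\<lambda>(x, i). E x i) ` ({1..p} \<times> {..<5}) = edges T"
      by (rule card_subset_eq[OF fin_e]) (use E_edge(1) card_image[OF inj] n in auto)
    with inj show ?thesis by (simp add: bij_betw_def)
  qed
  define \<theta> where "\<theta> = (\<lambda>(x, i). lab (E x i))"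
  have \<theta>: "bij_betw \<theta> ({1..p} \<times> {..<5}) {1..5 * p}"
    using bij_betw_trans[OF E_bij labbij] by (simp add: \<theta>_def comp_def case_prod_unfold)
  have "p > 0" using p r by simp
  with \<theta> have col: "five_columns p \<theta>" by unfold_locales
  interpret five_columns p \<theta> by fact
  have lab_image: "lab ` edges T = {1..5 * p}" using labbij by (simp add: bij_betw_def)
  have lab_inv: "inv_into (edges T) lab (lab e) = e" if "e \<in> edges T" for e
    using labbij that by (simp add: bij_betw_def)
  have s1: "sigma1 T lab = act (\<lambda>_. id) d"
  proof (rule act_eqI)
    fix x i :: nat assume x: "x \<in> {1..p}" "i < 5"
    have "sigma1 T lab (\<theta> (x, i)) = lab (R (\<omega> x) (E x i))"
      using E_edge[OF x(1), of i] by (simp add: sigma1_def \<theta>_def lab_inv R_def)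
    then show "sigma1 T lab (\<theta> (x, i)) = \<theta> (id x, (i + d) mod 5)"
      by (simp add: E_shift[OF x(1)] \<theta>_def)
  qed (auto simp: sigma1_def lab_image)
  have s0: "sigma0 T lab = act (pair_at 0 a b) 0"
  proof (rule act_eqI)
    fix x i :: nat assume x: "x \<in> {1..p}" "i < 5"
    let ?e = "E x i"
    have sig: "sigma0 T lab (\<theta> (x, i)) = lab (rot T (fst ?e) ?e)"
      using E_edge(1)[OF x(1), of i] by (simp add: sigma0_def \<theta>_def lab_inv Let_def)
    have e_eq: "?e = (fst ?e, \<omega> x)" using E_edge(2)[OF x(1), of i] by (simp add: prod_eq_iff)
    have fstb: "fst ?e \<in> black T" using E_edge(1)[OF x(1), of i] edges_bw by auto
    \<comment> \<open>By injectivity of \<open>E\<close>, an edge at \<open>b1\<close> lies in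
      column 0 and one at \<open>b2\<close> in column 1; every other black end is a leaf, where the
      rotation is trivial.\<close>
    consider "fst ?e = b1" | "fst ?e = b2" | "fst ?e \<noteq> b1" "fst ?e \<noteq> b2" by blast
    then have "sigma0 T lab (\<theta> (x, i)) = \<theta> (pair_at 0 a b i x, i)"
    proof cases
      case 1
      then have xA: "x \<in> A" using E_edge(1)[OF x(1), of i] e_eq x(1) by (simp add: A_def)
      have "?e = E x 0" using e_eq E_A[OF xA] 1 by simp
      then have i: "i = 0" using E_inj[of x i x 0] x by simp
      show ?thesis
        unfolding sig using A(4)[OF xA] by (simp add: i pair_at_def \<theta>_def E_A xA)
    next
      case 2
      then have xB: "x \<in> B" using E_edge(1)[OF x(1), of i] e_eq x(1) by (simp add: B_def)
      have "?e = E x 1" using e_eq E_B[OF xB] 2 by simp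
      then have i: "i = 1" using E_inj[of x i x 1] x by simp
      show ?thesis
        unfolding sig using B(4)[OF xB] by (simp add: i pair_at_def \<theta>_def E_B xB)
    next
      case 3
      have "rot T (fst ?e) ?e = ?e"
        by (rule rot_leaf[OF T]) (use 3 fstb deg(3) E_edge(1)[OF x(1)] in \<open>auto simp: incident_def\<close>)
      moreover have "pair_at 0 a b i x = x"
      proof -
        have "a x = x" if "i = 0"
          using 3(1) that E_A[of x] permutes_not_in[OF A(2), of x] by fastforce
        moreover have "b x = x" if "i = 1"
          using 3(2) that E_B[of x] permutes_not_in[OF B(2), of x] by fastforce
        ultimately show ?thesis by (simp add: pair_at_def)
      qed
      ultimately show ?thesis unfolding sig by (simp add: \<theta>_def)
    qed
    then show "sigma0 T lab (\<theta> (x, i)) = \<theta> (pair_at 0 a b ((i + 0) mod 5) x, (i + 0) mod 5)"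
      using x by simp
  qed (auto simp: sigma0_def lab_image)
  show thesis
    by (rule that[OF col A(2,1) B(2,1) AB AB_Un A(3) B(3) _ s0 s1, of e]) (use ed in \<open>simp add: mult.commute\<close>)
qed

theorem lemma8p2:
  fixes r s p n :: nat
    and T :: "'v bicolored_map"
    and lab :: "'v \<times> 'v \<Rightarrow> nat"
  assumes "r \<ge> 2" and "s > 0" and "p > 0" and "n > 0"
    and "n = 5 * p" and "n = 2 * r + s" and "p + s + 2 = n + 1"
    and "bicolored_plane_tree T"
    and "passport T = (replicate_mset 2 r + replicate_mset s 1, replicate_mset p 5, n)"
    and "edge_labelling T lab"
  shows
    "(odd r \<longrightarrow>
       (\<exists>\<phi> \<in> hom (integer_mod_group 5) (AutoGroup (power_group (alt_group p) 5)).
          monodromy_group T lab \<cong>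
            semidirect_product (power_group (alt_group p) 5) (integer_mod_group 5) \<phi>)) \<and>
     (even r \<longrightarrow>
       (\<exists>\<psi> \<in> hom (integer_mod_group 5) (AutoGroup (power_group (integer_mod_group 2) 4)).
        \<exists>\<phi> \<in> hom (semidirect_product (power_group (integer_mod_group 2) 4) (integer_mod_group 5) \<psi>)
               (AutoGroup (power_group (alt_group p) 5)).
          monodromy_group T lab \<cong>
            semidirect_product (power_group (alt_group p) 5)
              (semidirect_product (power_group (integer_mod_group 2) 4) (integer_mod_group 5) \<psi>) \<phi>))"
proof -
  \<comment> \<open>Substituting n = 5p and s = 5p - 2r into the vertex count p + s + 2 = n + 1
    leaves p = 2r - 1.\<close>
  have p: "p + 1 = 2 * r" using assms(5-7) by linarith
  have passport: "image_mset (vertex_degree T) (mset_set (black T)) = replicate_mset 2 r + replicate_mset s 1"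
    "image_mset (vertex_degree T) (mset_set (white T)) = replicate_mset p 5" "card (edges T) = 5 * p"
    using assms(5,9) by (simp_all add: passport_def)
  obtain \<theta> a b A B z d e where col: "five_columns p \<theta>"
    and ab: "a permutes A" "cyclic_on a A" "b permutes B" "cyclic_on b B"
      "A \<inter> B = {z}" "A \<union> B = {1..p}" "card A = r" "card B = r" and de: "(d * e) mod 5 = 1"
    and s0: "sigma0 T lab = five_columns.act p \<theta> (pair_at 0 a b) 0"
    and s1: "sigma1 T lab = five_columns.act p \<theta> (\<lambda>_. id) d"
    by (rule two_hub_tree_columns[OF assms(8) passport p assms(1,10)])
  interpret five_columns p \<theta> by fact
  have "a permutes {1..p}" "b permutes {1..p}" using ab by (auto intro: permutes_subset)
  \<comment> \<open>\<open>subgroup_generated\<close> intersects its generators with the carrier, so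
    both must be known to be permutations of \<open>{1..5 * p}\<close>.\<close>
  then have "{sigma0 T lab, sigma1 T lab} \<subseteq> carrier (sym_group (5 * p))"
    unfolding s0 s1 by (auto simp: sym_group_carrier pair_at_def permutes_id intro!: act_permutes)
  then have "monodromy_group T lab = sym_group (5 * p)\<lparr>carrier :=
      wreath (if odd r then carrier (alt_group p) else {f. f permutes {1..p}})\<rparr>"
    using generate_meeting_cycles[OF ab(1-8) assms(1) de]
    by (simp add: monodromy_group_def subgroup_generated_def passport(3) Int_absorb1 flip: s0 s1)
  moreover have "p \<ge> 2" using p assms(1) by linarith
  ultimately show ?thesis
    using wreath_alt_group wreath_sym_group by simp
qed

end
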